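(* Let $p,n\ge 1$, let $g\in\mathbb{C}[x_1,\dots,x_p]$ be a polynomial and let $f_1,\dots,f_n\in\mathbb{C}[x_1,\dots,x_p]$ be polynomials each of which satisfies Mahler's Hypothesis. Then the values at $s=0$, obtained by analytic continuation, of the Dirichlet series $$\zeta(s;f_j,g):=\sum_{k_1=0}^\infty\cdots\sum_{k_p=0}^\infty g(k_1,\dots,k_p)\,f_j(k_1,\dots,k_p)^{-s}\qquad(\mathrm{Re}(s)\gg0)$$ (and of the analogous series $\zeta\big(s;\prod_{j=1}^n f_j,g\big)$ attached to the product) satisfy $$\deg\Big(\prod_{j=1}^n f_j\Big)\cdot\zeta\Big(0;\prod_{j=1}^n f_j,\,g\Big)=\sum_{j=1}^n\deg(f_j)\cdot\zeta(0;f_j,g).$$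
   Context: Mahler's Hypothesis for $f\in\mathbb{C}[x_1,\dots,x_p]$: $f$ is non-constant, $f(x)\neq0$ for all $x\in[0,\infty)^p$, and the top-degree homogeneous part $f_{\mathrm{top}}$ of $f$ (the homogeneous part of degree $\deg(f)$) satisfies $f_{\mathrm{top}}(x)\ne0$ for all $x\in[0,\infty)^p\setminus\{0\}$. If $f$ and $h$ satisfy it, so does $fh$. Here $\deg$ is the total degree. For $f$ satisfying Mahler's Hypothesis, $f(x)^{-s}:=e^{-s\log f(x)}$, where $\log f$ is any continuous branch of the logarithm of $f$ on $[0,\infty)^p$ (one exists since $f$ does not vanish there; values of the continued series at integers $s$ do not depend on the choice). By a known theorem of Mahler, the series $\zeta(s;f,g)$ converges absolutely for $\mathrm{Re}(s)>(\deg(g)+p)/\deg(f)$, extends to a meromorphic function of $s\in\mathbb{C}$, and is regular at all $s=0,-1,-2,\dots$; $\zeta(0;f,g)$ denotes the value at $s=0$ of this continuation. *)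

theory Defs
  imports
    "HOL-Analysis.Analysis"
    "HOL-Complex_Analysis.Complex_Analysis"
    "HOL-Library.Poly_Mapping"
begin

text \<open>
  Polynomials in \<open>p = CARD('p)\<close> variables are finitely supported maps from exponent vectors to
  coefficients, with the convolution product that is the ring multiplication of \<open>\<Rightarrow>\<^sub>0\<close>.
\<close>

type_synonym ('p, 'a) mpoly = "('p \<Rightarrow>\<^sub>0 nat) \<Rightarrow>\<^sub>0 'a"

definition monom_degree :: "('p::finite \<Rightarrow>\<^sub>0 nat) \<Rightarrow> nat"
  where "monom_degree m = (\<Sum>i\<in>UNIV. Poly_Mapping.lookup m i)"

text \<open>The zero polynomial gets total degree 0.\<close>

definition total_degree :: "('p::finite, 'a::zero) mpoly \<Rightarrow> nat"
  where "total_degree f = Max (insert 0 (monom_degree ` Poly_Mapping.keys f))"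

definition eval_mpoly :: "('p::finite, 'a::comm_semiring_1) mpoly \<Rightarrow> ('p \<Rightarrow> 'a) \<Rightarrow> 'a"
  where "eval_mpoly f x = (\<Sum>m\<in>Poly_Mapping.keys f. Poly_Mapping.lookup f m * (\<Prod>i\<in>UNIV. x i ^ Poly_Mapping.lookup m i))"

definition homogeneous_part :: "nat \<Rightarrow> ('p::finite, 'a::comm_monoid_add) mpoly \<Rightarrow> ('p, 'a) mpoly"
  where "homogeneous_part d f =
    (\<Sum>m | m \<in> Poly_Mapping.keys f \<and> monom_degree m = d. Poly_Mapping.single m (Poly_Mapping.lookup f m))"

definition top_part :: "('p::finite, 'a::comm_monoid_add) mpoly \<Rightarrow> ('p, 'a) mpoly"
  where "top_part f = homogeneous_part (total_degree f) f"

definition constant_mpoly :: "('p, 'a::zero) mpoly \<Rightarrow> bool"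
  where "constant_mpoly f \<longleftrightarrow> (\<exists>c. f = Poly_Mapping.single 0 c)"

definition nonneg_orthant :: "(real ^ 'p) set"
  where "nonneg_orthant = {x. \<forall>i. 0 \<le> x $ i}"

definition eval_real :: "('p::finite, complex) mpoly \<Rightarrow> real ^ 'p \<Rightarrow> complex"
  where "eval_real f x = eval_mpoly f (\<lambda>i. complex_of_real (x $ i))"

definition Mahler_hypothesis :: "('p::finite, complex) mpoly \<Rightarrow> bool"
  where "Mahler_hypothesis f \<longleftrightarrow>
    \<not> constant_mpoly f \<and>
    (\<forall>x\<in>nonneg_orthant. eval_real f x \<noteq> 0) \<and>
    (\<forall>x\<in>nonneg_orthant - {0}. eval_real (top_part f) x \<noteq> 0)"

definition log_branch :: "('p::finite, complex) mpoly \<Rightarrow> (real ^ 'p \<Rightarrow> complex) \<Rightarrow> bool"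
  where "log_branch f L \<longleftrightarrow>
    continuous_on nonneg_orthant L \<and> (\<forall>x\<in>nonneg_orthant. exp (L x) = eval_real f x)"

definition lattice_point :: "('p::finite \<Rightarrow> nat) \<Rightarrow> real ^ 'p"
  where "lattice_point k = (\<chi> i. real (k i))"

text \<open>
  The summand is \<open>g(k) f(k)\<^sup>-\<^sup>s\<close> for the branch \<open>L\<close> of \<open>log f\<close>. In \<^typ>\<open>complex\<close>, unordered
  summability (\<^const>\<open>has_sum\<close>) is absolute summability. A nicely meromorphic function takes its
  limit value at every point that is not a pole and the value 0 at poles, so that there is at most
  one continuation in the following sense.
\<close>

definition is_zeta_continuation ::
  "('p::finite, complex) mpoly \<Rightarrow> (real ^ 'p \<Rightarrow> complex) \<Rightarrow> ('p, complex) mpoly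
    \<Rightarrow> (complex \<Rightarrow> complex) \<Rightarrow> bool"
  where "is_zeta_continuation f L g Z \<longleftrightarrow>
    Z nicely_meromorphic_on UNIV \<and>
    (\<forall>s. Re s > real (total_degree g + CARD('p)) / real (total_degree f) \<longrightarrow>
      ((\<lambda>k. eval_real g (lattice_point k) * exp (- s * L (lattice_point k))) has_sum Z s)
        (UNIV :: ('p \<Rightarrow> nat) set))"

lemma is_zeta_continuation_unique:
  assumes "is_zeta_continuation f L g Z1" "is_zeta_continuation f L g Z2"
  shows "Z1 = Z2"
proof
  fix z
  define c where "c = real (total_degree g + CARD('a)) / real (total_degree f)"
  have nm: "Z1 nicely_meromorphic_on UNIV" "Z2 nicely_meromorphic_on UNIV"
    using assms by (auto simp: is_zeta_continuation_def)
  hence m: "Z1 meromorphic_on UNIV" "Z2 meromorphic_on UNIV"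
    by (auto simp: nicely_meromorphic_on_def)
  have eq: "Z1 s = Z2 s" if "Re s > c" for s
    using assms that unfolding is_zeta_continuation_def c_def by (blast intro: has_sum_unique)
  have "(\<forall>\<^sub>\<approx>s\<in>UNIV. Z1 s - Z2 s = 0) \<or> (\<forall>\<^sub>\<approx>s\<in>UNIV. Z1 s - Z2 s \<noteq> 0)"
    by (intro meromorphic_imp_constant_or_avoid meromorphic_on_diff m) auto
  moreover have "\<not> (\<forall>\<^sub>\<approx>s\<in>UNIV. Z1 s - Z2 s \<noteq> 0)"
  proof
    assume "\<forall>\<^sub>\<approx>s\<in>UNIV. Z1 s - Z2 s \<noteq> 0"
    hence "eventually (\<lambda>s. Z1 s - Z2 s \<noteq> 0) (at (of_real (c + 1)))"
      by (auto simp: eventually_cosparse_open_eq)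
    moreover have "eventually (\<lambda>s. s \<in> {s. Re s > c}) (at (of_real (c + 1)))"
      by (intro eventually_at_in_open') (auto simp: open_halfspace_Re_gt)
    ultimately have "eventually (\<lambda>s::complex. False) (at (of_real (c + 1)))"
      by eventually_elim (use eq in auto)
    thus False by simp
  qed
  ultimately have ev: "eventually (\<lambda>s. Z1 s = Z2 s) (at z)"
    by (auto simp: eventually_cosparse_open_eq)
  have pole: "is_pole Z1 z \<longleftrightarrow> is_pole Z2 z"
    by (intro is_pole_cong ev) auto
  have lim: "(Z1 \<longlongrightarrow> l) (at z) \<longleftrightarrow> (Z2 \<longlongrightarrow> l) (at z)" for l
    by (intro tendsto_cong ev)
  have "is_pole Z1 z \<and> Z1 z = 0 \<or> Z1 \<midarrow>z\<rightarrow> Z1 z" "is_pole Z2 z \<and> Z2 z = 0 \<or> Z2 \<midarrow>z\<rightarrow> Z2 z"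
    using nm by (auto simp: nicely_meromorphic_on_def)
  moreover have "\<not> is_pole Z1 z" if "Z1 \<midarrow>z\<rightarrow> l" for l
    using that not_tendsto_and_filterlim_at_infinity[of "at z" Z1 l] by (auto simp: is_pole_def)
  ultimately show "Z1 z = Z2 z"
    using pole lim by (metis LIM_unique)
qed

definition Mahler_zeta ::
  "('p::finite, complex) mpoly \<Rightarrow> (real ^ 'p \<Rightarrow> complex) \<Rightarrow> ('p, complex) mpoly
    \<Rightarrow> complex \<Rightarrow> complex"
  where "Mahler_zeta f L g = (THE Z. is_zeta_continuation f L g Z)"

end

(*
Split the lattice as k = 2 l + e with e in {0,1}^p.  If L = log f and the factor f(2l+e) / (2^d f(l))
is 1 + O(1/|l|), then the amplitude a of order m in the series Z_a(s) = sum_k a(k) exp(-s L(k)) obeys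
(2^(d s) - 2^(p+m)) Z_a(s) = sum_e Z_(T_e a)(s), where each T_e a has order m - 1.  Iterating continues
Z_a to all of C.  Amplitudes for which this can be iterated ("symbols") are those a, of order m, for
which a(2l+e) - 2^m a(l) is again a symbol, of order m - 1.

At s = 0 the recursion shows that d times the residue of Z_a does not depend on L.  For a polynomial g
of degree n, T_e g = (g(2l+e) - 2^n g(l)) - s g(2l+e) h_e(l) + O(s^2), where
h_e(l) = L(2l+e) - L(l) - d log 2.  So d Z_g(0) is computed from residues that depend linearly on h_e,
hence additively on L, and the logarithm of a product is the sum of the logarithms up to a constant.
*)
theory Submission
  imports Defs
begin

section \<open>Dyadic symbols\<close>

text \<open>Three obstacles shape the details. Each doubling multiplies the amplitude by exp(-s
  h_e), so amplitudes must be families entire in s, with bounds locally uniform in s. The notion of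
  symbol refers to itself at a lower order, so it is stratified by a depth: closure properties are
  proved by induction on the depth, and a symbol has every depth.

  A pole at s = 0 can arise only at order m = -p, where the doubling factor is 2^(d s) - 1, about s
  d log 2. At s = 0 the factors exp(-s h_e) are 1, so L enters the residue only through this d. A
  nonzero polynomial has order n >= 0, its factor at 0 is 1 - 2^(p+n), and the recursion ends at the
  zero polynomial.

  Values of f determine h_e only modulo 2 pi i. Along the segment from l to 2l+e the polynomial f
  stays close to (1+t)^d f(l), which identifies h_e with the principal logarithm of f(2l+e) / (2^d
  f(l)) for all but finitely many l. The exceptions are harmless, because a finitely supported
  function is a symbol of every order.\<close>

definition wt :: "('p::finite \<Rightarrow> nat) \<Rightarrow> real"
  where "wt k = 1 + (\<Sum>i\<in>UNIV. real (k i))"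

definition dbl :: "'p set \<Rightarrow> ('p \<Rightarrow> nat) \<Rightarrow> 'p \<Rightarrow> nat"
  where "dbl A k = (\<lambda>i. 2 * k i + of_bool (i \<in> A))"

text \<open>The constant may depend on \<open>R\<close> but not on \<open>k\<close>; this local
  uniformity in \<open>s\<close> is what the Weierstrass test for the sum over the lattice
  uses.\<close>

definition has_order :: "real \<Rightarrow> (complex \<Rightarrow> ('p::finite \<Rightarrow> nat) \<Rightarrow> complex) \<Rightarrow> bool"
  where "has_order e b \<longleftrightarrow> (\<forall>k. (\<lambda>s. b s k) holomorphic_on UNIV) \<and>
    (\<forall>R. \<exists>C. \<forall>s k. norm s \<le> R \<longrightarrow> norm (b s k) \<le> C * wt k powr e)"

text \<open>If \<open>b\<close> is homogeneous of degree \<open>e\<close>, its difference for the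
  empty set \<open>A\<close> vanishes. The condition thus imitates an asymptotic expansion into
  homogeneous terms of degrees \<open>e\<close>, \<open>e - 1\<close>, ..., without
  derivatives.\<close>

primrec symbol_upto :: "nat \<Rightarrow> real \<Rightarrow> (complex \<Rightarrow> ('p::finite \<Rightarrow> nat) \<Rightarrow> complex) \<Rightarrow> bool"
  where
    "symbol_upto 0 e b \<longleftrightarrow> has_order e b"
  | "symbol_upto (Suc N) e b \<longleftrightarrow> has_order e b \<and>
      (\<forall>A. symbol_upto N (e - 1) (\<lambda>s k. b s (dbl A k) - of_real (2 powr e) * b s k))"

definition symbol :: "real \<Rightarrow> (complex \<Rightarrow> ('p::finite \<Rightarrow> nat) \<Rightarrow> complex) \<Rightarrow> bool"
  where "symbol e b \<longleftrightarrow> (\<forall>N. symbol_upto N e b)"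

lemma wt_ge_1: "wt k \<ge> 1"
  by (simp add: wt_def sum_nonneg)

lemma wt_pos: "wt k > 0"
  using wt_ge_1[of k] by linarith

lemma wt_dbl: "wt (dbl A k) = 2 * wt k - 1 + real (card A)"
proof -
  have "(\<Sum>i\<in>UNIV. of_bool (i \<in> A)) = real (card A)"
    by (simp add: of_bool_def flip: sum.inter_filter)
  thus ?thesis
    by (simp add: wt_def dbl_def sum.distrib sum_distrib_left)
qed

lemma wt_le_dbl: "wt k \<le> wt (dbl A k)"
  using wt_ge_1[of k] by (simp add: wt_dbl)

lemma wt_dbl_le: "wt (dbl A k) \<le> (2 + CARD('p)) * wt (k :: 'p::finite \<Rightarrow> nat)"
proof -
  have "real (card A) \<le> CARD('p)"
    by (simp add: card_mono)
  also have "\<dots> \<le> CARD('p) * wt k"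
    using wt_ge_1[of k] by simp
  finally show ?thesis
    by (simp add: wt_dbl algebra_simps)
qed

text \<open>One constant for both signs of the exponent: the summand 1 serves negative
  \<open>e\<close>, where doubling cannot increase the power, and the other summand serves the
  rest.\<close>

lemma wt_powr_dbl_le:
  "wt (dbl A k) powr e \<le> (1 + (2 + CARD('p)) powr e) * wt (k :: 'p::finite \<Rightarrow> nat) powr e"
proof (cases "e \<ge> 0")
  case True
  hence "wt (dbl A k) powr e \<le> ((2 + CARD('p)) * wt k) powr e"
    using wt_dbl_le[of A k] wt_pos[of "dbl A k"] by (intro powr_mono2) auto
  also have "\<dots> = (2 + CARD('p)) powr e * wt k powr e"
    using wt_pos[of k] by (simp add: powr_mult)
  finally show ?thesis
    by (simp add: algebra_simps add_increasing)
next
  case False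
  hence "wt (dbl A k) powr e \<le> wt k powr e"
    using wt_le_dbl[of k A] wt_pos[of k] by (intro powr_mono2') auto
  thus ?thesis
    by (simp add: algebra_simps add_increasing2)
qed

lemma has_orderI:
  assumes "\<And>k. (\<lambda>s. b s k) holomorphic_on UNIV"
    and "\<And>R. \<exists>C. \<forall>s k. norm s \<le> R \<longrightarrow> norm (b s k) \<le> C * wt k powr e"
  shows "has_order e b"
  using assms by (auto simp: has_order_def)

lemma has_orderE:
  assumes "has_order e b"
  obtains C where "C \<ge> 0" "\<And>s k. norm s \<le> R \<Longrightarrow> norm (b s k) \<le> C * wt k powr e"
proof -
  obtain C where C: "\<And>s k. norm s \<le> R \<Longrightarrow> norm (b s k) \<le> C * wt k powr e"
    using assms unfolding has_order_def by meson
  show ?thesis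
  proof (rule that[of "\<bar>C\<bar>"])
    fix s :: complex and k
    assume "norm s \<le> R"
    thus "norm (b s k) \<le> \<bar>C\<bar> * wt k powr e"
      using C[of s k] by (meson abs_ge_self dual_order.trans mult_right_mono powr_ge_zero)
  qed auto
qed

lemma has_order_holomorphic: "has_order e b \<Longrightarrow> (\<lambda>s. b s k) holomorphic_on A"
  unfolding has_order_def by (meson holomorphic_on_subset top_greatest)

lemma has_order_add:
  assumes "has_order e a" "has_order e b"
  shows "has_order e (\<lambda>s k. a s k + b s k)"
proof (rule has_orderI)
  show "(\<lambda>s. a s k + b s k) holomorphic_on UNIV" for k
    using assms by (intro holomorphic_intros has_order_holomorphic)
next
  fix R :: real
  obtain C where C: "\<And>s k. norm s \<le> R \<Longrightarrow> norm (a s k) \<le> C * wt k powr e"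
    using has_orderE[OF assms(1)] by metis
  obtain D where D: "\<And>s k. norm s \<le> R \<Longrightarrow> norm (b s k) \<le> D * wt k powr e"
    using has_orderE[OF assms(2)] by metis
  have "norm (a s k + b s k) \<le> (C + D) * wt k powr e" if "norm s \<le> R" for s k
    using C[OF that, of k] D[OF that, of k] norm_triangle_ineq[of "a s k" "b s k"]
    by (simp add: algebra_simps)
  thus "\<exists>C. \<forall>s k. norm s \<le> R \<longrightarrow> norm (a s k + b s k) \<le> C * wt k powr e"
    by blast
qed

lemma has_order_mult:
  assumes "has_order e a" "has_order e' b"
  shows "has_order (e + e') (\<lambda>s k. a s k * b s k)"
proof (rule has_orderI)
  show "(\<lambda>s. a s k * b s k) holomorphic_on UNIV" for k
    using assms by (intro holomorphic_intros has_order_holomorphic)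
next
  fix R :: real
  obtain C where C: "C \<ge> 0" "\<And>s k. norm s \<le> R \<Longrightarrow> norm (a s k) \<le> C * wt k powr e"
    using has_orderE[OF assms(1)] by metis
  obtain D where D: "D \<ge> 0" "\<And>s k. norm s \<le> R \<Longrightarrow> norm (b s k) \<le> D * wt k powr e'"
    using has_orderE[OF assms(2)] by metis
  have "norm (a s k * b s k) \<le> (C * D) * wt k powr (e + e')" if "norm s \<le> R" for s k
  proof -
    have "norm (a s k) * norm (b s k) \<le> (C * wt k powr e) * (D * wt k powr e')"
      using C(1) by (intro mult_mono C(2) D(2) that) auto
    thus ?thesis
      by (simp add: norm_mult powr_add algebra_simps)
  qed
  thus "\<exists>C. \<forall>s k. norm s \<le> R \<longrightarrow> norm (a s k * b s k) \<le> C * wt k powr (e + e')"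
    by blast
qed

lemma has_order_entire:
  assumes "h holomorphic_on UNIV"
  shows "has_order 0 (\<lambda>s k. h s)"
proof (rule has_orderI)
  fix R :: real
  have "compact (h ` cball 0 R)"
    by (intro compact_continuous_image holomorphic_on_imp_continuous_on
        holomorphic_on_subset[OF assms]) auto
  then obtain C where "\<And>z. z \<in> h ` cball 0 R \<Longrightarrow> norm z \<le> C"
    using compact_imp_bounded bounded_iff by metis
  hence "norm (h s) \<le> C * wt k powr 0" if "norm s \<le> R" for s and k :: "'a \<Rightarrow> nat"
    using that wt_pos[of k] by auto
  thus "\<exists>C. \<forall>s (k :: 'a \<Rightarrow> nat). norm s \<le> R \<longrightarrow> norm (h s) \<le> C * wt k powr 0"
    by blast
qed (use assms in auto)

lemma has_order_mono:
  assumes "has_order e b" "e \<le> e'"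
  shows "has_order e' b"
proof (rule has_orderI)
  show "(\<lambda>s. b s k) holomorphic_on UNIV" for k
    using assms by (intro has_order_holomorphic)
next
  fix R :: real
  obtain C where C: "C \<ge> 0" "\<And>s k. norm s \<le> R \<Longrightarrow> norm (b s k) \<le> C * wt k powr e"
    using has_orderE[OF assms(1)] by metis
  have "norm (b s k) \<le> C * wt k powr e'" if "norm s \<le> R" for s k
    using C(2)[OF that, of k] C(1) wt_ge_1[of k] assms(2)
    by (meson mult_left_mono order_trans powr_mono)
  thus "\<exists>C. \<forall>s k. norm s \<le> R \<longrightarrow> norm (b s k) \<le> C * wt k powr e'"
    by blast
qed

lemma has_order_dbl:
  assumes "has_order e b"
  shows "has_order e (\<lambda>s k. b s (dbl A k))"
proof (rule has_orderI)
  show "(\<lambda>s. b s (dbl A k)) holomorphic_on UNIV" for k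
    using assms by (intro has_order_holomorphic)
next
  fix R :: real
  obtain C where C: "C \<ge> 0" "\<And>s k. norm s \<le> R \<Longrightarrow> norm (b s k) \<le> C * wt k powr e"
    using has_orderE[OF assms(1)] by metis
  have "norm (b s (dbl A k)) \<le> (C * (1 + (2 + CARD('a)) powr e)) * wt k powr e"
    if "norm s \<le> R" for s k
    using C(2)[OF that, of "dbl A k"] mult_left_mono[OF wt_powr_dbl_le[of A k e] C(1)]
    by (simp add: mult.assoc)
  thus "\<exists>C. \<forall>s k. norm s \<le> R \<longrightarrow> norm (b s (dbl A k)) \<le> C * wt k powr e"
    by blast
qed

lemma symbol_upto_has_order: "symbol_upto N e b \<Longrightarrow> has_order e b"
  by (cases N) auto

section \<open>Finite-depth symbols: algebra, reciprocals, composition\<close>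

lemma symbol_upto_add:
  "symbol_upto N e a \<Longrightarrow> symbol_upto N e b \<Longrightarrow> symbol_upto N e (\<lambda>s k. a s k + b s k)"
proof (induction N arbitrary: e a b)
  case (Suc N)
  have "symbol_upto N (e - 1)
      (\<lambda>s k. (a s (dbl A k) - of_real (2 powr e) * a s k) +
              (b s (dbl A k) - of_real (2 powr e) * b s k))" for A
    using Suc.prems by (intro Suc.IH) auto
  thus ?case
    using Suc.prems by (simp add: has_order_add algebra_simps)
qed (simp add: has_order_add)

lemma has_order_entire_mult:
  assumes "h holomorphic_on UNIV" "has_order e b"
  shows "has_order e (\<lambda>s k. h s * b s k)"
  using has_order_mult[OF has_order_entire[OF assms(1)] assms(2)] by simp

lemma symbol_upto_entire_mult:
  assumes "h holomorphic_on UNIV"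
  shows "symbol_upto N e b \<Longrightarrow> symbol_upto N e (\<lambda>s k. h s * b s k)"
proof (induction N arbitrary: e b)
  case (Suc N)
  have "symbol_upto N (e - 1) (\<lambda>s k. h s * (b s (dbl A k) - of_real (2 powr e) * b s k))" for A
    using Suc.prems by (intro Suc.IH) auto
  thus ?case
    using Suc.prems by (simp add: has_order_entire_mult[OF assms] algebra_simps)
qed (simp add: has_order_entire_mult[OF assms])

lemma symbol_upto_cmult: "symbol_upto N e b \<Longrightarrow> symbol_upto N e (\<lambda>s k. c * b s k)"
  by (rule symbol_upto_entire_mult) auto

lemma symbol_upto_diff:
  assumes "symbol_upto N e a" "symbol_upto N e b"
  shows "symbol_upto N e (\<lambda>s k. a s k - b s k)"
  using symbol_upto_add[OF assms(1) symbol_upto_cmult[OF assms(2), of "-1"]] by simp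

lemma symbol_upto_Suc_imp: "symbol_upto (Suc N) e b \<Longrightarrow> symbol_upto N e b"
proof (induction N arbitrary: e b)
  case (Suc N)
  show ?case
    unfolding symbol_upto.simps(2)
  proof (intro conjI allI Suc.IH)
    fix A
    show "symbol_upto (Suc N) (e - 1) (\<lambda>s k. b s (dbl A k) - complex_of_real (2 powr e) * b s k)"
      using Suc.prems symbol_upto.simps(2) by blast
  qed (use Suc.prems in auto)
qed simp

text \<open>Counted one order higher, the doubling difference needs no cancellation: both of its
  terms already have order \<open>e - 1\<close>. The depth gained here drives the induction for
  compositions.\<close>

lemma symbol_upto_shift: "symbol_upto N (e - 1) b \<Longrightarrow> symbol_upto (Suc N) e b"
proof (induction N arbitrary: e b)
  case 0
  have "symbol_upto 0 (e - 1) (\<lambda>s k. b s (dbl A k) - of_real (2 powr e) * b s k)" for A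
    using 0 by (intro symbol_upto_diff symbol_upto_cmult) (auto intro: has_order_dbl)
  moreover have "has_order e b"
    using 0 has_order_mono[of "e - 1" b e] by simp
  ultimately show ?case
    by simp
next
  case (Suc N)
  have "symbol_upto (Suc N) (e - 1) (\<lambda>s k. b s (dbl A k) - of_real (2 powr e) * b s k)" for A
  proof -
    have "symbol_upto (Suc N) (e - 1) (\<lambda>s k. b s (dbl A k) - of_real (2 powr (e - 1)) * b s k)"
      using Suc.prems by (intro Suc.IH) auto
    hence "symbol_upto (Suc N) (e - 1)
        (\<lambda>s k. (b s (dbl A k) - of_real (2 powr (e - 1)) * b s k)
             + (of_real (2 powr (e - 1)) - of_real (2 powr e)) * b s k)"
      using Suc.prems by (intro symbol_upto_add symbol_upto_cmult)
    thus ?thesis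
      by (simp add: algebra_simps)
  qed
  moreover have "has_order e b"
    using symbol_upto_has_order[OF Suc.prems] has_order_mono[of "e - 1" b e] by simp
  ultimately show ?case
    using symbol_upto.simps(2) by blast
qed

lemma symbol_upto_up: "symbol_upto N (e - 1) b \<Longrightarrow> symbol_upto N e b"
  by (rule symbol_upto_Suc_imp[OF symbol_upto_shift])

lemma symbol_upto_SucD:
  "symbol_upto (Suc N) e b \<Longrightarrow>
     symbol_upto N (e - 1) (\<lambda>s k. b s (dbl A k) - of_real (2 powr e) * b s k)"
  by simp

lemma symbol_upto_dbl:
  assumes "symbol_upto (Suc N) e b"
  shows "symbol_upto N e (\<lambda>s k. b s (dbl A k))"
proof -
  have "symbol_upto N e (\<lambda>s k. (b s (dbl A k) - of_real (2 powr e) * b s k) + of_real (2 powr e) * b s k)"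
    by (intro symbol_upto_add symbol_upto_cmult symbol_upto_up[OF symbol_upto_SucD[OF assms]]
      symbol_upto_Suc_imp[OF assms])
  thus ?thesis by simp
qed

text \<open>A Leibniz rule: the difference of a product is the difference of \<open>a\<close> times
  the doubled \<open>b\<close>, plus \<open>2 powr e\<close> times \<open>a\<close> times the
  difference of \<open>b\<close>. Doubling \<open>b\<close> costs one level of depth, which the
  induction step has to spare.\<close>

lemma symbol_upto_mult:
  "symbol_upto N e a \<Longrightarrow> symbol_upto N e' b \<Longrightarrow> symbol_upto N (e + e') (\<lambda>s k. a s k * b s k)"
proof (induction N arbitrary: e e' a b)
  case (Suc N)
  have "symbol_upto N (e + e' - 1)
      (\<lambda>s k. (a s (dbl A k) - of_real (2 powr e) * a s k) * b s (dbl A k) +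
         of_real (2 powr e) * (a s k * (b s (dbl A k) - of_real (2 powr e') * b s k)))" for A
  proof -
    have "symbol_upto N (e - 1 + e') (\<lambda>s k. (a s (dbl A k) - of_real (2 powr e) * a s k) * b s (dbl A k))"
      using Suc.prems by (intro Suc.IH symbol_upto_SucD symbol_upto_dbl)
    moreover have "symbol_upto N (e + (e' - 1)) (\<lambda>s k. a s k * (b s (dbl A k) - of_real (2 powr e') * b s k))"
      using Suc.prems by (intro Suc.IH symbol_upto_SucD symbol_upto_Suc_imp[OF Suc.prems(1)])
    ultimately show ?thesis
      by (intro symbol_upto_add symbol_upto_cmult) (simp_all add: algebra_simps)
  qed
  moreover have "has_order (e + e') (\<lambda>s k. a s k * b s k)"
    using Suc.prems by (intro has_order_mult symbol_upto_has_order)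
  ultimately show ?case
    by (simp add: algebra_simps powr_add)
qed (simp add: has_order_mult)

lemma symbol_upto_zero: "symbol_upto N e (\<lambda>s (k :: 'p::finite \<Rightarrow> nat). 0)"
proof (induction N arbitrary: e)
  case 0
  show ?case by (auto simp: has_order_def intro: exI[of _ 0])
next
  case (Suc N)
  have "has_order e (\<lambda>s (k :: 'p \<Rightarrow> nat). 0)"
    by (rule symbol_upto_has_order[OF Suc.IH])
  thus ?case using Suc.IH by simp
qed

lemma symbol_upto_entire:
  assumes "h holomorphic_on UNIV"
  shows "symbol_upto N 0 (\<lambda>s k. h s)"
  using assms by (cases N) (auto intro: has_order_entire symbol_upto_zero)

text \<open>The difference of the reciprocals is \<open>- (2 powr (- d))\<close> times the
  difference of \<open>f\<close>, divided by \<open>f k * f (dbl A k)\<close>. As \<open>d\<close>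
  is nonnegative and doubling does not lower the weight, the lower bound passes to the doubled
  function, so the induction hypothesis covers both reciprocals.\<close>

lemma symbol_upto_inverse:
  assumes "d \<ge> 0" "c > 0"
  shows "symbol_upto N d (\<lambda>_. f) \<Longrightarrow> (\<And>k. norm (f k) \<ge> c * wt k powr d) \<Longrightarrow>
    symbol_upto N (- d) (\<lambda>_ k. inverse (f k))"
proof (induction N arbitrary: f)
  case 0
  show ?case unfolding symbol_upto.simps
  proof (rule has_orderI)
    fix R :: real
    have "norm (inverse (f k)) \<le> inverse c * wt k powr (- d)" for k
    proof -
      have "inverse (norm (f k)) \<le> inverse (c * wt k powr d)"
        using assms(2) wt_pos[of k] by (intro le_imp_inverse_le 0) auto
      thus ?thesis by (simp add: norm_inverse powr_minus)
    qed
    thus "\<exists>C. \<forall>s k. norm (s :: complex) \<le> R \<longrightarrow> norm (inverse (f k)) \<le> C * wt k powr - d"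
      by blast
  qed auto
next
  case (Suc N)
  have f0: "f k \<noteq> 0" for k
  proof -
    have "0 < c * wt k powr d" using assms(2) wt_pos[of k] by simp
    thus ?thesis using Suc.prems(2)[of k] by auto
  qed
  have lower: "norm (f (dbl A k)) \<ge> c * wt k powr d" for A k
  proof -
    have "wt k powr d \<le> wt (dbl A k) powr d"
      using assms(1) wt_le_dbl[of k A] wt_pos[of k] by (intro powr_mono2) auto
    thus ?thesis
      using Suc.prems(2)[of "dbl A k"] assms(2) mult_left_mono[of _ _ c]
      by (meson less_imp_le order_trans)
  qed
  have "symbol_upto N (-d - 1) (\<lambda>s k. inverse (f (dbl A k)) - of_real (2 powr (-d)) * inverse (f k))" for A
  proof -
    have "symbol_upto N (d - 1 + (- d + - d)) (\<lambda>s k. (f (dbl A k) - of_real (2 powr d) * f k) *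
       (inverse (f k) * inverse (f (dbl A k))))"
      using lower Suc.prems(2)
      by (intro symbol_upto_mult Suc.IH symbol_upto_SucD[OF Suc.prems(1)]
          symbol_upto_Suc_imp[OF Suc.prems(1)] symbol_upto_dbl[OF Suc.prems(1)])
    hence "symbol_upto N (- d - 1) (\<lambda>s k. - of_real (2 powr (-d)) * ((f (dbl A k) - of_real (2 powr d) * f k) *
       (inverse (f k) * inverse (f (dbl A k)))))"
      by (intro symbol_upto_cmult) simp
    moreover have "- of_real (2 powr (-d)) * ((f (dbl A k) - of_real (2 powr d) * f k) *
       (inverse (f k) * inverse (f (dbl A k)))) = inverse (f (dbl A k)) - of_real (2 powr (-d)) * inverse (f k)" for k
      using f0[of k] f0[of "dbl A k"] by (simp add: powr_minus field_simps)
    ultimately show ?thesis by simp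
  qed
  moreover have "has_order (- d) (\<lambda>s k. inverse (f k))"
    by (intro symbol_upto_has_order[OF Suc.IH] symbol_upto_Suc_imp[OF Suc.prems(1)] Suc.prems(2))
  ultimately show ?case by simp
qed

lemma inj_dbl: "inj (dbl A)"
proof (rule injI, rule ext)
  fix k l i
  assume "dbl A k = dbl A l"
  hence "dbl A k i = dbl A l i" by simp
  thus "k i = l i" by (simp add: dbl_def)
qed

lemma finite_wt_le: "finite {k :: 'p::finite \<Rightarrow> nat. wt k \<le> B}"
proof (rule finite_subset)
  show "{k. wt k \<le> B} \<subseteq> PiE UNIV (\<lambda>_::'p. {..nat \<lceil>B\<rceil>})"
  proof safe
    fix k :: "'p \<Rightarrow> nat" and i
    assume "wt k \<le> B"
    moreover have "real (k i) \<le> (\<Sum>i\<in>UNIV. real (k i))"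
      by (rule member_le_sum) auto
    ultimately have "real (k i) \<le> B"
      unfolding wt_def by linarith
    thus "k i \<le> nat \<lceil>B\<rceil>" by linarith
  qed auto
qed (simp add: finite_PiE)

text \<open>Since \<open>dbl A\<close> is injective, doubling differences inherit finite support.
  This lets a symbol be altered freely at the lattice points of small weight.\<close>

lemma symbol_upto_finite_support:
  "finite {k. a k \<noteq> 0} \<Longrightarrow> symbol_upto N e (\<lambda>_. a)"
proof (induction N arbitrary: e a)
  case 0
  show ?case unfolding symbol_upto.simps
  proof (rule has_orderI)
    fix R :: real
    let ?K = "{k. a k \<noteq> 0}"
    have "norm (a k) \<le> (\<Sum>k\<in>?K. norm (a k) * wt k powr (- e)) * wt k powr e" for k
    proof (cases "a k = 0")
      case False
      have "norm (a k) * wt k powr (- e) \<le> (\<Sum>k\<in>?K. norm (a k) * wt k powr (- e))"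
        using 0 False by (intro member_le_sum) auto
      hence "norm (a k) * wt k powr (- e) * wt k powr e \<le> (\<Sum>k\<in>?K. norm (a k) * wt k powr (- e)) * wt k powr e"
        by (intro mult_right_mono) auto
      moreover have "norm (a k) * wt k powr (- e) * wt k powr e = norm (a k)"
        using wt_pos[of k] by (simp add: powr_minus field_simps)
      ultimately show ?thesis by simp
    qed (auto intro!: mult_nonneg_nonneg sum_nonneg)
    thus "\<exists>C. \<forall>s k. norm (s::complex) \<le> R \<longrightarrow> norm (a k) \<le> C * wt k powr e"
      by blast
  qed auto
next
  case (Suc N)
  have "symbol_upto N (e - 1) (\<lambda>s k. a (dbl A k) - of_real (2 powr e) * a k)" for A
  proof (rule Suc.IH)
    have "{k. a (dbl A k) - of_real (2 powr e) * a k \<noteq> 0} \<subseteq> dbl A -` {k. a k \<noteq> 0} \<union> {k. a k \<noteq> 0}"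
      by auto
    thus "finite {k. a (dbl A k) - of_real (2 powr e) * a k \<noteq> 0}"
      by (rule finite_subset) (use finite_vimageI[OF Suc.prems inj_dbl] Suc.prems in auto)
  qed
  moreover have "has_order e (\<lambda>_. a)"
    by (rule symbol_upto_has_order[OF Suc.IH[OF Suc.prems]])
  ultimately show ?case by simp
qed

text \<open>With the divided difference \<open>\<psi>\<close> of \<open>\<phi>\<close> at 0,
  \<open>\<phi> u = \<phi> 0 + u * \<psi> u\<close>. The product has order -1 at depth
  \<open>N\<close>, hence order 0 at depth \<open>Suc N\<close>. The induction therefore ranges over
  all \<open>\<phi>\<close> holomorphic on \<open>S\<close>; the compact ranges supply the bounds at
  depth 0.\<close>

lemma symbol_upto_compose:
  assumes "open S" "0 \<in> S" "symbol (- 1) u"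
    and range: "\<And>R. \<exists>K. compact K \<and> K \<subseteq> S \<and> (\<forall>s k. norm s \<le> R \<longrightarrow> u s k \<in> K)"
  shows "\<phi> holomorphic_on S \<Longrightarrow> symbol_upto N 0 (\<lambda>s k. \<phi> (u s k))"
proof (induction N arbitrary: \<phi>)
  case 0
  show ?case unfolding symbol_upto.simps
  proof (rule has_orderI)
    fix k
    have "u s k \<in> S" for s
      using range[of "norm s"] by auto
    moreover have "(\<lambda>s. u s k) holomorphic_on UNIV"
      using assms(3) unfolding symbol_def by (intro has_order_holomorphic symbol_upto_has_order) auto
    ultimately show "(\<lambda>s. \<phi> (u s k)) holomorphic_on UNIV"
      using holomorphic_on_compose_gen[OF _ 0, of "\<lambda>s. u s k" UNIV] by (auto simp: o_def)
  next
    fix R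
    obtain K where K: "compact K" "K \<subseteq> S" "\<And>s k. norm s \<le> R \<Longrightarrow> u s k \<in> K"
      using range by meson
    have "compact (\<phi> ` K)"
      using K 0 by (intro compact_continuous_image holomorphic_on_imp_continuous_on)
        (auto intro: holomorphic_on_subset)
    then obtain C where "\<And>z. z \<in> \<phi> ` K \<Longrightarrow> norm z \<le> C"
      using compact_imp_bounded bounded_iff by metis
    hence "norm (\<phi> (u s k)) \<le> C * wt k powr 0" if "norm s \<le> R" for s k
      using K(3)[OF that] wt_pos[of k] by auto
    thus "\<exists>C. \<forall>s k. norm s \<le> R \<longrightarrow> norm (\<phi> (u s k)) \<le> C * wt k powr 0"
      by blast
  qed
next
  case (Suc N)
  define \<psi> where "\<psi> = (\<lambda>z. if z = 0 then deriv \<phi> 0 else (\<phi> z - \<phi> 0) / (z - 0))"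
  have "\<psi> holomorphic_on S"
    unfolding \<psi>_def by (rule pole_lemma_open[OF Suc.prems assms(1)])
  hence "symbol_upto N (- 1 + 0) (\<lambda>s k. u s k * \<psi> (u s k))"
    using assms(3) by (intro symbol_upto_mult Suc.IH) (auto simp: symbol_def)
  hence "symbol_upto (Suc N) 0 (\<lambda>s k. u s k * \<psi> (u s k))"
    by (intro symbol_upto_shift) simp
  hence "symbol_upto (Suc N) 0 (\<lambda>s k. \<phi> 0 + u s k * \<psi> (u s k))"
    by (intro symbol_upto_add symbol_upto_entire) auto
  moreover have "\<phi> 0 + z * \<psi> z = \<phi> z" for z
    by (simp add: \<psi>_def)
  ultimately show ?case
    by simp
qed


section \<open>Symbols of every depth\<close>

lemma symbol_has_order: "symbol e b \<Longrightarrow> has_order e b"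
  unfolding symbol_def using symbol_upto_has_order by blast

lemma symbol_add: "symbol e a \<Longrightarrow> symbol e b \<Longrightarrow> symbol e (\<lambda>s k. a s k + b s k)"
  by (simp add: symbol_def symbol_upto_add)

lemma symbol_entire_mult:
  "h holomorphic_on UNIV \<Longrightarrow> symbol e b \<Longrightarrow> symbol e (\<lambda>s k. h s * b s k)"
  by (simp add: symbol_def symbol_upto_entire_mult)

lemma symbol_cmult: "symbol e b \<Longrightarrow> symbol e (\<lambda>s k. c * b s k)"
  by (simp add: symbol_def symbol_upto_cmult)

lemma symbol_mult: "symbol e a \<Longrightarrow> symbol e' b \<Longrightarrow> symbol (e + e') (\<lambda>s k. a s k * b s k)"
  by (simp add: symbol_def symbol_upto_mult)

lemma symbol_dbl: "symbol e b \<Longrightarrow> symbol e (\<lambda>s k. b s (dbl A k))"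
  by (simp add: symbol_def symbol_upto_dbl del: symbol_upto.simps)

lemma symbol_dbl_diff:
  "symbol e b \<Longrightarrow> symbol (e - 1) (\<lambda>s k. b s (dbl A k) - of_real (2 powr e) * b s k)"
  unfolding symbol_def using symbol_upto_SucD by blast

lemma symbol_zero: "symbol e (\<lambda>s k. 0)"
  by (simp add: symbol_def symbol_upto_zero)

lemma symbol_sum:
  "(\<And>j. j \<in> J \<Longrightarrow> symbol e (b j)) \<Longrightarrow> symbol e (\<lambda>s k. \<Sum>j\<in>J. b j s k)"
  by (induction J rule: infinite_finite_induct) (auto intro: symbol_add symbol_zero)

lemma symbol_compose:
  assumes "open S" "0 \<in> S" "symbol (- 1) u" "\<phi> holomorphic_on S"
    and "\<And>R. \<exists>K. compact K \<and> K \<subseteq> S \<and> (\<forall>s k. norm s \<le> R \<longrightarrow> u s k \<in> K)"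
  shows "symbol 0 (\<lambda>s k. \<phi> (u s k))"
  unfolding symbol_def using symbol_upto_compose[OF assms(1-3,5,4)] by blast

text \<open>With no constant term, \<open>u\<close> splits off as a factor and its order survives.
  The two uses are exp z - 1, for the twisted amplitudes, and Ln (1 + z), for the logarithm of a
  quotient near 1.\<close>

lemma symbol_compose_vanishing:
  assumes "open S" "0 \<in> S" "symbol (- 1) u" "\<phi> holomorphic_on S" "\<phi> 0 = 0"
    and "\<And>R. \<exists>K. compact K \<and> K \<subseteq> S \<and> (\<forall>s k. norm s \<le> R \<longrightarrow> u s k \<in> K)"
  shows "symbol (- 1) (\<lambda>s k. \<phi> (u s k))"
proof -
  define \<psi> where "\<psi> = (\<lambda>z. if z = 0 then deriv \<phi> 0 else (\<phi> z - \<phi> 0) / (z - 0))"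
  have "\<psi> holomorphic_on S"
    unfolding \<psi>_def by (rule pole_lemma_open[OF assms(4,1)])
  hence "symbol 0 (\<lambda>s k. \<psi> (u s k))"
    by (intro symbol_compose[OF assms(1-3) _ assms(6)])
  hence "symbol (- 1 + 0) (\<lambda>s k. u s k * \<psi> (u s k))"
    by (intro symbol_mult assms(3))
  moreover have "z * \<psi> z = \<phi> z" for z
    using assms(5) by (simp add: \<psi>_def)
  ultimately show ?thesis by simp
qed

lemma entire_range_compact:
  assumes "has_order e u" "e \<le> 0"
  shows "\<exists>K. compact K \<and> K \<subseteq> UNIV \<and> (\<forall>s k. norm s \<le> R \<longrightarrow> u s k \<in> K)"
proof -
  obtain C where C: "\<And>s k. norm s \<le> R \<Longrightarrow> norm (u s k) \<le> C * wt k powr 0"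
    using has_orderE[OF has_order_mono[OF assms]] by metis
  hence "\<forall>s k. norm s \<le> R \<longrightarrow> u s k \<in> cball 0 C"
    using wt_pos by (metis mem_cball_0 mult.right_neutral order_less_irrefl powr_zero_eq_one)
  thus ?thesis
    by (intro exI[of _ "cball 0 C"]) auto
qed

section \<open>Sums over the lattice\<close>

text \<open>The weight dominates each 1 + k_i, so its power is at most the product of the powers (1
  + k_i)^(-\<sigma>/p), and one-dimensional series with exponent \<sigma>/p > 1 multiply.\<close>

lemma summable_wt_powr:
  assumes "\<sigma> > real CARD('p)"
  shows "(\<lambda>k :: 'p::finite \<Rightarrow> nat. wt k powr (- \<sigma>)) summable_on UNIV"
proof -
  define \<tau> where "\<tau> = \<sigma> / real CARD('p)"
  have \<tau>: "\<tau> > 1" "\<tau> * real CARD('p) = \<sigma>"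
    using assms by (auto simp: \<tau>_def)
  have "summable (\<lambda>n. real (Suc n) powr (- \<tau>))"
    using \<tau>(1) summable_Suc_iff[of "\<lambda>n. real n powr (- \<tau>)"] by (simp add: summable_real_powr_iff)
  hence "Infinite_Set_Sum.abs_summable_on (\<lambda>n. real (Suc n) powr (- \<tau>)) UNIV"
    by (simp add: abs_summable_on_nat_iff')
  hence "Infinite_Set_Sum.abs_summable_on
      (\<lambda>k :: 'p \<Rightarrow> nat. \<Prod>i\<in>UNIV. real (Suc (k i)) powr (- \<tau>)) (PiE UNIV (\<lambda>_. UNIV))"
    by (intro abs_summable_on_prod_PiE) auto
  hence "(\<lambda>k :: 'p \<Rightarrow> nat. norm (\<Prod>i\<in>UNIV. real (Suc (k i)) powr (- \<tau>))) summable_on UNIV"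
    unfolding abs_summable_equivalent[symmetric] by simp
  hence summable: "(\<lambda>k :: 'p \<Rightarrow> nat. \<Prod>i\<in>UNIV. real (Suc (k i)) powr (- \<tau>)) summable_on UNIV"
    by (simp add: prod_nonneg)
  show ?thesis
  proof (rule abs_summable_summable, rule Infinite_Sum.abs_summable_on_comparison_test'[OF summable])
    fix k :: "'p \<Rightarrow> nat"
    have "real (Suc (k i)) \<le> wt k" for i
      using member_le_sum[of i UNIV "\<lambda>i. real (k i)"] by (simp add: wt_def)
    hence "wt k powr (- \<tau>) \<le> real (Suc (k i)) powr (- \<tau>)" for i
      using \<tau>(1) by (intro powr_mono2') auto
    hence "(\<Prod>i\<in>(UNIV :: 'p set). wt k powr (- \<tau>)) \<le> (\<Prod>i\<in>UNIV. real (Suc (k i)) powr (- \<tau>))"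
      by (intro prod_mono) auto
    moreover have "(\<Prod>i\<in>(UNIV :: 'p set). wt k powr (- \<tau>)) = wt k powr (- \<sigma>)"
      using wt_pos[of k] \<tau>(2) by (simp add: powr_powr flip: powr_realpow)
    ultimately show "norm (wt k powr (- \<sigma>)) \<le> (\<Prod>i\<in>UNIV. real (Suc (k i)) powr (- \<tau>))"
      by simp
  qed
qed

text \<open>Last binary digits: \<open>A\<close> collects the odd coordinates.\<close>

lemma bij_dbl: "bij (\<lambda>(A, k). dbl A k)"
proof (rule bij_betw_byWitness[where f' = "\<lambda>k. ({i. odd (k i)}, \<lambda>i. k i div 2)"])
  show "\<forall>x\<in>UNIV. (\<lambda>k. ({i. odd (k i)}, \<lambda>i. k i div 2)) (case x of (A, k) \<Rightarrow> dbl A k) = x"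
    by (auto simp: dbl_def fun_eq_iff)
qed (auto simp: dbl_def fun_eq_iff)

lemma dbl_div_2: "dbl {i. odd (k i)} (\<lambda>i. k i div 2) = k"
  by (auto simp: dbl_def fun_eq_iff)

lemma infsum_dbl:
  fixes F :: "('p::finite \<Rightarrow> nat) \<Rightarrow> complex"
  assumes "F summable_on UNIV" "\<And>A. (\<lambda>k. F (dbl A k)) summable_on UNIV"
  shows "infsum F UNIV = (\<Sum>A\<in>UNIV. infsum (\<lambda>k. F (dbl A k)) UNIV)"
proof -
  have "((\<lambda>x. F (case x of (A, k) \<Rightarrow> dbl A k)) has_sum infsum F UNIV) (UNIV \<times> UNIV)"
    using assms(1) has_sum_reindex_bij_betw[OF bij_dbl, of F "infsum F UNIV"] by simp
  hence "((\<lambda>A. infsum (\<lambda>k. F (dbl A k)) UNIV) has_sum infsum F UNIV) UNIV"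
    by (rule has_sum_SigmaD) (use assms(2) in auto)
  moreover have "((\<lambda>A. infsum (\<lambda>k. F (dbl A k)) UNIV) has_sum
      (\<Sum>A\<in>UNIV. infsum (\<lambda>k. F (dbl A k)) UNIV)) UNIV"
    by (rule has_sum_finite) simp
  ultimately show ?thesis
    by (rule has_sum_unique)
qed

section \<open>Logarithms known through their increments under doubling\<close>

definition log_increment ::
    "(('p::finite \<Rightarrow> nat) \<Rightarrow> complex) \<Rightarrow> real \<Rightarrow> 'p set \<Rightarrow> ('p \<Rightarrow> nat) \<Rightarrow> complex"
  where "log_increment \<Lambda> D A k = \<Lambda> (dbl A k) - \<Lambda> k - of_real (D * ln 2)"

text \<open>The continuation sees a polynomial only through these increments at lattice points. For
  a product of polynomials the axioms can then be checked by adding the increments of the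
  factors.\<close>

locale log_symbol =
  fixes \<Lambda> :: "('p::finite \<Rightarrow> nat) \<Rightarrow> complex" and D :: real
  assumes D_pos: "D > 0"
    and symbol_increment: "symbol (- 1) (\<lambda>_. log_increment \<Lambda> D A)"
begin

text \<open>Repeated halving carries every lattice point to the origin. One halving costs an error
  of size O(1 / wt), and the weights along the way grow geometrically, so the total error stays
  bounded. This turns knowledge of increments into the growth of
  \<open>exp (- s * \<Lambda> k)\<close>.\<close>

lemma log_symbol_near_ln:
  obtains C where "C \<ge> 0" "\<And>k. norm (\<Lambda> k - of_real (D * ln (wt k))) \<le> C"
proof -
  define \<Phi> where "\<Phi> = (\<lambda>k. \<Lambda> k - of_real (D * ln (wt k)))"
  have "\<forall>A. \<exists>C\<ge>0. \<forall>k. norm (log_increment \<Lambda> D A k) \<le> C * wt k powr (- 1)"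
    using has_orderE[OF symbol_has_order[OF symbol_increment], of 0] by (metis norm_zero order_refl)
  then obtain c where c: "\<And>A. c A \<ge> 0" "\<And>A k. norm (log_increment \<Lambda> D A k) \<le> c A * wt k powr (- 1)"
    by metis
  \<comment> \<open>The second summand pays for replacing \<open>wt (dbl A k)\<close> by
    \<open>2 * wt k\<close> under the logarithm.\<close>
  define C where "C = (\<Sum>A\<in>UNIV. c A) + D * real CARD('p)"
  have C0: "C \<ge> 0"
    using c(1) D_pos by (auto simp: C_def intro!: add_nonneg_nonneg sum_nonneg)
  have step: "norm (\<Phi> (dbl A k)) \<le> norm (\<Phi> k) + C / wt k" for A k
  proof -
    define x where "x = wt (dbl A k) / (2 * wt k)"
    have w: "wt k \<ge> 1" "wt k > 0" "wt (dbl A k) > 0" by (simp_all add: wt_ge_1 wt_pos)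
    have x: "x > 0" using w by (simp add: x_def)
    have cardA: "real (card A) \<le> real CARD('p)" by (simp add: card_mono)
    have "x - 1 = (real (card A) - 1) / (2 * wt k)"
      using w by (simp add: x_def wt_dbl field_simps)
    also have "\<dots> \<le> (2 * real CARD('p)) / (2 * wt k)"
      using w cardA by (intro divide_right_mono) auto
    finally have "ln x \<le> real CARD('p) / wt k"
      using ln_le_minus_one[OF x] by simp
    moreover have "- ln x \<le> real CARD('p) / wt k"
    proof -
      have "- ln x = ln (1 / x)"
        using x by (simp add: ln_div)
      also have "\<dots> \<le> 1 / x - 1"
        using x by (intro ln_le_minus_one) auto
      also have "\<dots> = (1 - real (card A)) / wt (dbl A k)"
        using w by (simp add: x_def wt_dbl field_simps)
      also have "\<dots> \<le> 1 / wt (dbl A k)"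
        using w by (intro divide_right_mono) auto
      also have "\<dots> \<le> 1 / wt k"
        using w wt_le_dbl[of k A] by (intro divide_left_mono) auto
      also have "\<dots> \<le> real CARD('p) / wt k"
        using w by (intro divide_right_mono) (auto simp: Suc_le_eq)
      finally show ?thesis .
    qed
    ultimately have lnx: "\<bar>ln x\<bar> \<le> real CARD('p) / wt k" by linarith
    have "ln (wt (dbl A k)) = ln x + ln 2 + ln (wt k)"
      using w by (simp add: x_def ln_div ln_mult)
    hence "\<Phi> (dbl A k) = \<Phi> k + (log_increment \<Lambda> D A k - of_real (D * ln x))"
      by (simp add: \<Phi>_def log_increment_def algebra_simps)
    hence "norm (\<Phi> (dbl A k)) \<le> norm (\<Phi> k) + (norm (log_increment \<Lambda> D A k) + norm (of_real (D * ln x) :: complex))"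
      by (simp only:) (rule order_trans[OF norm_triangle_ineq add_left_mono[OF norm_triangle_ineq4]])
    moreover have "norm (log_increment \<Lambda> D A k) \<le> (\<Sum>A\<in>UNIV. c A) / wt k"
    proof -
      have "c A \<le> (\<Sum>A\<in>UNIV. c A)"
        using c(1) by (intro member_le_sum) auto
      hence "c A / wt k \<le> (\<Sum>A\<in>UNIV. c A) / wt k"
        using w by (intro divide_right_mono) auto
      moreover have "c A * wt k powr (- 1) = c A / wt k"
        using w by (simp add: powr_minus divide_inverse)
      ultimately show ?thesis using c(2)[of A k] by linarith
    qed
    moreover have "norm (of_real (D * ln x) :: complex) \<le> D * real CARD('p) / wt k"
      using mult_left_mono[OF lnx, of D] D_pos by (simp add: norm_mult abs_mult)
    ultimately show ?thesis
      by (simp add: C_def add_divide_distrib)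
  qed
  \<comment> \<open>The term \<open>- 3 * C / wt k\<close> in the bound below is a reserve that pays
    for halving: a step costs \<open>C / wt l\<close>, while the reserve drops from
    \<open>3 * C / wt l\<close> to at most \<open>2 * C / wt l\<close>. The origin has weight 1,
    which explains \<open>3 * C\<close> here.\<close>
  define E where "E = norm (\<Phi> (\<lambda>_. 0)) + 3 * C"
  have bound: "norm (\<Phi> k) \<le> E - 3 * C / wt k" for k
  proof (induction "\<Sum>i\<in>UNIV. k i" arbitrary: k rule: less_induct)
    case less
    show ?case
    proof (cases "k = (\<lambda>_. 0)")
      case True
      thus ?thesis by (simp add: E_def wt_def)
    next
      case False
      define A l where "A = {i. odd (k i)}" and "l = (\<lambda>i. k i div 2)"
      have k: "k = dbl A l"
        by (simp add: A_def l_def dbl_div_2)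
      obtain i where "k i \<noteq> 0" using False by auto
      hence "(\<Sum>i\<in>UNIV. l i) < (\<Sum>i\<in>UNIV. k i)"
        by (intro sum_strict_mono_ex1) (auto simp: l_def intro!: exI[of _ i])
      hence "norm (\<Phi> l) \<le> E - 3 * C / wt l"
        by (rule less)
      \<comment> \<open>The factor 2 is out of reach because
        \<open>wt (dbl {} l) = 2 * wt l - 1\<close>; the value 3/2 is attained at
        \<open>wt l = 2\<close>. For \<open>l = 0\<close> the set \<open>A\<close> cannot be
        empty.\<close>
      moreover have "wt k \<ge> 3/2 * wt l"
      proof (cases "l = (\<lambda>_. 0)")
        case True
        hence "A \<noteq> {}" using False k by (auto simp: dbl_def)
        hence "real (card A) \<ge> 1" by (simp add: Suc_le_eq card_gt_0_iff)
        thus ?thesis using True wt_dbl[of A l] k by (simp add: wt_def)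
      next
        case False
        then obtain j where j: "l j \<noteq> 0" by auto
        have "real (l j) \<le> (\<Sum>i\<in>UNIV. real (l i))"
          by (rule member_le_sum) auto
        hence "wt l \<ge> 2" using j by (simp add: wt_def)
        thus ?thesis using wt_dbl[of A l] k by simp
      qed
      hence "3 * C / wt k \<le> 3 * C / (3/2 * wt l)"
        using C0 wt_pos[of k] wt_pos[of l] by (intro divide_left_mono) auto
      hence "3 * C / wt k \<le> 3 * C / wt l - C / wt l"
        by (simp add: diff_divide_distrib[symmetric])
      ultimately show ?thesis
        using step[of A l] unfolding k[symmetric] by linarith
    qed
  qed
  have "norm (\<Phi> k) \<le> E" for k
  proof -
    have "0 \<le> 3 * C / wt k"
      using C0 wt_pos[of k] by simp
    thus ?thesis using bound[of k] by linarith
  qed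
  moreover have "E \<ge> 0" using C0 by (simp add: E_def)
  ultimately show ?thesis using that by (auto simp: \<Phi>_def)
qed

definition summand :: "(complex \<Rightarrow> ('p \<Rightarrow> nat) \<Rightarrow> complex) \<Rightarrow> complex \<Rightarrow> ('p \<Rightarrow> nat) \<Rightarrow> complex"
  where "summand b s k = b s k * exp (- s * \<Lambda> k)"

text \<open>The bounded deviation of \<open>\<Lambda>\<close> from \<open>D * ln wt\<close> costs
  only a constant factor while \<open>s\<close> is bounded. Comparison with the exponent
  \<open>- p\<close> then yields the abscissa \<open>(e + p) / D\<close>.\<close>

lemma summand_bound:
  assumes "has_order e b"
  obtains C where "C \<ge> 0"
    "\<And>s k. norm s \<le> R \<Longrightarrow> norm (summand b s k) \<le> C * wt k powr (e - D * Re s)"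
proof -
  obtain B where B: "B \<ge> 0" "\<And>k. norm (\<Lambda> k - of_real (D * ln (wt k))) \<le> B"
    using log_symbol_near_ln by metis
  obtain C where C: "C \<ge> 0" "\<And>s k. norm s \<le> R \<Longrightarrow> norm (b s k) \<le> C * wt k powr e"
    using has_orderE[OF assms] by metis
  show ?thesis
  proof (rule that[of "C * exp (R * B)"])
    fix s :: complex and k
    assume s: "norm s \<le> R"
    define \<Phi> where "\<Phi> = \<Lambda> k - of_real (D * ln (wt k))"
    have "- Re (s * \<Phi>) \<le> norm (s * \<Phi>)"
      using abs_Re_le_cmod[of "s * \<Phi>"] by linarith
    also have "\<dots> \<le> R * B"
      unfolding norm_mult using s B by (intro mult_mono) (auto simp: \<Phi>_def order_trans[OF norm_ge_zero s])
    finally have "exp (- Re (s * \<Phi>)) \<le> exp (R * B)" by simp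
    moreover have "- s * \<Lambda> k = of_real (- D * ln (wt k)) * s - s * \<Phi>"
      by (simp add: \<Phi>_def algebra_simps)
    hence "norm (exp (- s * \<Lambda> k)) = wt k powr (- D * Re s) * exp (- Re (s * \<Phi>))"
      using wt_pos[of k] by (simp only: norm_exp_eq_Re) (simp add: powr_def algebra_simps flip: exp_add)
    ultimately have "norm (exp (- s * \<Lambda> k)) \<le> wt k powr (- D * Re s) * exp (R * B)"
      by (simp add: mult_left_mono)
    hence "norm (b s k) * norm (exp (- s * \<Lambda> k)) \<le>
        (C * wt k powr e) * (wt k powr (- D * Re s) * exp (R * B))"
      using C by (intro mult_mono C(2) s) auto
    thus "norm (summand b s k) \<le> C * exp (R * B) * wt k powr (e - D * Re s)"
      by (simp add: summand_def norm_mult powr_diff powr_minus field_simps)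
  qed (use C in auto)
qed

lemma summand_uniform_bound:
  assumes "has_order e b" "c > (e + real CARD('p)) / D"
  obtains M where "M summable_on UNIV"
    "\<And>s k. norm s \<le> R \<Longrightarrow> Re s \<ge> c \<Longrightarrow> norm (summand b s k) \<le> M k"
proof -
  obtain C where C: "C \<ge> 0"
      "\<And>s k. norm s \<le> R \<Longrightarrow> norm (summand b s k) \<le> C * wt k powr (e - D * Re s)"
    using summand_bound[OF assms(1)] by metis
  have "D * c - e > real CARD('p)"
    using assms(2) D_pos by (simp add: field_simps)
  hence "(\<lambda>k :: 'p \<Rightarrow> nat. C * wt k powr (- (D * c - e))) summable_on UNIV"
    by (intro summable_on_cmult_right summable_wt_powr)
  moreover have "norm (summand b s k) \<le> C * wt k powr (- (D * c - e))"
    if "norm s \<le> R" "Re s \<ge> c" for s k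
  proof -
    have "wt k powr (e - D * Re s) \<le> wt k powr (- (D * c - e))"
      using wt_ge_1[of k] that(2) D_pos by (intro powr_mono) auto
    thus ?thesis
      using C(2)[OF that(1), of k] C(1) by (meson mult_left_mono order_trans)
  qed
  ultimately show ?thesis using that by blast
qed

lemma summable_summand:
  assumes "has_order e b" "Re s > (e + real CARD('p)) / D"
  shows "summand b s summable_on UNIV"
proof -
  obtain M where M: "M summable_on UNIV"
      "\<And>s' k. norm s' \<le> norm s \<Longrightarrow> Re s' \<ge> Re s \<Longrightarrow> norm (summand b s' k) \<le> M k"
    using summand_uniform_bound[OF assms] by metis
  show ?thesis
    by (rule abs_summable_summable, rule Infinite_Sum.abs_summable_on_comparison_test'[OF M(1)])
       (rule M(2)[OF order_refl order_refl])
qed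

lemma holomorphic_infsum_summand:
  assumes "has_order e b"
  shows "(\<lambda>s. infsum (summand b s) UNIV) holomorphic_on {s. Re s > (e + real CARD('p)) / D}"
proof -
  let ?c = "(e + real CARD('p)) / D"
  have "(\<lambda>s. infsum (summand b s) UNIV) holomorphic_on ball z ((Re z - ?c) / 2)"
    if z: "Re z > ?c" for z
  proof -
    \<comment> \<open>Half the distance to the boundary line: the whole closed disc keeps distance
      at least \<open>r\<close> from it, so a single majorant serves.\<close>
    define r where "r = (Re z - ?c) / 2"
    have "?c + r > ?c"
      using z by (simp add: r_def)
    then obtain M where M: "M summable_on UNIV"
        "\<And>s k. norm s \<le> norm z + r \<Longrightarrow> Re s \<ge> ?c + r \<Longrightarrow> norm (summand b s k) \<le> M k"
      using summand_uniform_bound[OF assms, of "?c + r" "norm z + r"] by metis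
    have ulim: "uniform_limit (cball z r) (\<lambda>X s. \<Sum>k\<in>X. summand b s k)
        (\<lambda>s. infsum (summand b s) UNIV) (finite_subsets_at_top UNIV)"
    proof (rule Weierstrass_m_test_general[OF _ M(1)])
      fix k s
      assume s: "s \<in> cball z r"
      have "norm s \<le> norm z + r"
        using s norm_triangle_ineq2[of s z] by (simp add: dist_norm norm_minus_commute)
      moreover have "Re s \<ge> ?c + r"
        using s abs_Re_le_cmod[of "z - s"] unfolding r_def by (simp add: dist_norm) (linarith | argo)
      ultimately show "norm (summand b s k) \<le> M k"
        by (rule M(2))
    qed
    have "(\<lambda>s. \<Sum>k\<in>X. summand b s k) holomorphic_on UNIV" for X
      unfolding summand_def using assms by (intro holomorphic_intros has_order_holomorphic)
    hence "continuous_on (cball z r) (\<lambda>s. \<Sum>k\<in>X. summand b s k) \<and>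
        (\<lambda>s. \<Sum>k\<in>X. summand b s k) holomorphic_on ball z r" for X
      by (meson holomorphic_on_imp_continuous_on holomorphic_on_subset top_greatest)
    thus ?thesis
      using holomorphic_uniform_limit[OF always_eventually ulim] unfolding r_def by auto
  qed
  hence "(\<lambda>s. infsum (summand b s) UNIV) field_differentiable (at z)" if "Re z > ?c" for z
    using that by (intro holomorphic_on_imp_differentiable_at[of _ "ball z ((Re z - ?c) / 2)"]) auto
  thus ?thesis
    by (auto simp: holomorphic_on_def intro: field_differentiable_at_within)
qed

section \<open>Analytic continuation by doubling\<close>

text \<open>The exponential is the quotient of \<open>exp (- s * \<Lambda>)\<close> at
  \<open>dbl A k\<close> and at \<open>k\<close>, freed of its main factor 2^(-D s); subtracting the
  leading part \<open>2 powr e\<close> lowers the order by one.\<close>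

definition twist :: "real \<Rightarrow> 'p set \<Rightarrow> (complex \<Rightarrow> ('p \<Rightarrow> nat) \<Rightarrow> complex) \<Rightarrow>
    complex \<Rightarrow> ('p \<Rightarrow> nat) \<Rightarrow> complex"
  where "twist e A b s k = b s (dbl A k) * exp (- s * log_increment \<Lambda> D A k) - of_real (2 powr e) * b s k"

definition doubling_factor :: "real \<Rightarrow> complex \<Rightarrow> complex"
  where "doubling_factor e s = exp (s * of_real (D * ln 2)) - of_real (2 powr (real CARD('p) + e))"

text \<open>Depth \<open>N\<close> is meaningful where \<open>D * Re s > e + p - N\<close>, since
  the innermost amplitudes have order \<open>e - N\<close>. Elsewhere the sums may diverge and take
  the default value 0, as does the quotient at a zero of the doubling factor.\<close>

primrec zeta_upto :: "nat \<Rightarrow> real \<Rightarrow> (complex \<Rightarrow> ('p \<Rightarrow> nat) \<Rightarrow> complex) \<Rightarrow> complex \<Rightarrow> complex"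
  where
    "zeta_upto 0 e b s = infsum (summand b s) UNIV"
  | "zeta_upto (Suc N) e b s =
      (\<Sum>A\<in>UNIV. zeta_upto N (e - 1) (twist e A b) s) / doubling_factor e s"

lemma symbol_exp_increment:
  "symbol (- 1) (\<lambda>s k. exp (- s * log_increment \<Lambda> D A k) - 1)"
proof -
  have u: "symbol (- 1) (\<lambda>s k. - s * log_increment \<Lambda> D A k)"
    by (rule symbol_entire_mult[OF holomorphic_on_minus[OF holomorphic_on_ident] symbol_increment])
  show ?thesis
    by (rule symbol_compose_vanishing[OF open_UNIV UNIV_I u, where \<phi> = "\<lambda>z. exp z - 1"])
       (intro holomorphic_intros, simp, rule entire_range_compact[OF symbol_has_order[OF u]], simp)
qed

lemma symbol_twist:
  assumes "symbol e b"
  shows "symbol (e - 1) (twist e A b)"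
proof -
  have "symbol (e + (- 1)) (\<lambda>s k. b s (dbl A k) * (exp (- s * log_increment \<Lambda> D A k) - 1))"
    by (intro symbol_mult symbol_dbl symbol_exp_increment assms)
  hence "symbol (e - 1) (\<lambda>s k. (b s (dbl A k) - of_real (2 powr e) * b s k)
      + b s (dbl A k) * (exp (- s * log_increment \<Lambda> D A k) - 1))"
    by (intro symbol_add symbol_dbl_diff assms) simp
  moreover have "twist e A b = (\<lambda>s k. (b s (dbl A k) - of_real (2 powr e) * b s k)
      + b s (dbl A k) * (exp (- s * log_increment \<Lambda> D A k) - 1))"
    by (simp add: twist_def fun_eq_iff algebra_simps)
  ultimately show ?thesis by simp
qed

lemma doubling_factor_nonzero:
  assumes "Re s > (e + real CARD('p)) / D"
  shows "doubling_factor e s \<noteq> 0"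
proof
  assume "doubling_factor e s = 0"
  hence "norm (exp (s * of_real (D * ln 2))) = norm (of_real (2 powr (real CARD('p) + e)) :: complex)"
    by (simp add: doubling_factor_def)
  hence "2 powr (D * Re s) = 2 powr (real CARD('p) + e)"
    by (simp add: powr_def algebra_simps)
  moreover have "D * Re s > real CARD('p) + e"
    using assms D_pos by (simp add: field_simps)
  hence "2 powr (real CARD('p) + e) < 2 powr (D * Re s)"
    by (intro powr_less_mono) auto
  ultimately show False by simp
qed

text \<open>Up to the common factor 2^(-D s), each of the 2^p classes modulo 2 contributes its
  twisted series plus \<open>2 powr e\<close> times the full series. Collecting the copies of the
  full series leaves the doubling factor.\<close>

lemma doubling_identity:
  assumes b: "symbol e b" and s: "Re s > (e + real CARD('p)) / D"
  shows "(\<Sum>A\<in>UNIV. infsum (summand (twist e A b) s) UNIV) = doubling_factor e s * infsum (summand b s) UNIV"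
proof -
  have s': "Re s > (e - 1 + real CARD('p)) / D"
    using s D_pos by (simp add: field_simps)
  have sum_b: "summand b s summable_on UNIV"
    by (rule summable_summand[OF symbol_has_order[OF b] s])
  have sum_T: "summand (twist e A b) s summable_on UNIV" for A
    by (rule summable_summand[OF symbol_has_order[OF symbol_twist[OF b]] s'])
  let ?q = "exp (s * of_real (D * ln 2))"
  have dbl: "summand b s (dbl A k) = inverse ?q *
      (summand (twist e A b) s k + of_real (2 powr e) * summand b s k)" for A k
  proof -
    have "- s * \<Lambda> (dbl A k) = - (s * of_real (D * ln 2)) + (- s * log_increment \<Lambda> D A k) + (- s * \<Lambda> k)"
      by (simp add: log_increment_def algebra_simps)
    hence "exp (- s * \<Lambda> (dbl A k)) = inverse ?q * exp (- s * log_increment \<Lambda> D A k) * exp (- s * \<Lambda> k)"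
      by (simp only: exp_add exp_minus)
    thus ?thesis
      by (simp add: summand_def twist_def algebra_simps)
  qed
  have "infsum (summand b s) UNIV = (\<Sum>A\<in>UNIV. infsum (\<lambda>k. summand b s (dbl A k)) UNIV)"
    unfolding dbl by (intro infsum_dbl[of "summand b s", unfolded dbl] summable_on_cmult_right summable_on_add sum_b sum_T)
  also have "\<dots> = (\<Sum>A\<in>UNIV. inverse ?q *
      (infsum (summand (twist e A b) s) UNIV + of_real (2 powr e) * infsum (summand b s) UNIV))"
    unfolding dbl
    by (intro sum.cong refl) (simp add: infsum_cmult_right infsum_add summable_on_cmult_right summable_on_add sum_b sum_T)
  also have "\<dots> = inverse ?q * ((\<Sum>A\<in>UNIV. infsum (summand (twist e A b) s) UNIV)
      + 2 ^ CARD('p) * of_real (2 powr e) * infsum (summand b s) UNIV)"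
    by (simp add: sum_distrib_left[symmetric] sum.distrib card_Pow flip: Pow_UNIV)
  finally have "?q * infsum (summand b s) UNIV = (\<Sum>A\<in>UNIV. infsum (summand (twist e A b) s) UNIV)
      + 2 ^ CARD('p) * of_real (2 powr e) * infsum (summand b s) UNIV"
    by (simp add: field_simps)
  moreover have "of_real (2 powr (real CARD('p) + e)) = (2 ^ CARD('p) * of_real (2 powr e) :: complex)"
    by (simp add: powr_add powr_realpow)
  ultimately show ?thesis
    by (simp add: doubling_factor_def algebra_simps)
qed

lemma zeta_upto_Suc_eq:
  "symbol e b \<Longrightarrow> Re s > (e + real CARD('p) - real N) / D \<Longrightarrow> zeta_upto (Suc N) e b s = zeta_upto N e b s"
proof (induction N arbitrary: e b)
  case 0
  thus ?case
    using doubling_identity[of e b s] doubling_factor_nonzero[of e s] by simp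
next
  case (Suc N)
  have "zeta_upto (Suc N) (e - 1) (twist e A b) s = zeta_upto N (e - 1) (twist e A b) s" for A
    using Suc.prems by (intro Suc.IH symbol_twist) (auto simp: algebra_simps)
  thus ?case
    by (simp only: zeta_upto.simps)
qed

lemma zeta_upto_eq:
  assumes "symbol e b" "Re s > (e + real CARD('p) - real N) / D" "N \<le> M"
  shows "zeta_upto M e b s = zeta_upto N e b s"
  using assms(3)
proof (induction M rule: dec_induct)
  case (step M)
  have "(e + real CARD('p) - real M) / D \<le> (e + real CARD('p) - real N) / D"
    using step D_pos by (intro divide_right_mono) auto
  thus ?case
    using step zeta_upto_Suc_eq[OF assms(1), of M s] assms(2) by simp
qed simp

lemma meromorphic_doubling_factor: "doubling_factor e meromorphic_on A"
proof -
  have "doubling_factor e holomorphic_on UNIV"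
    unfolding doubling_factor_def by (intro holomorphic_intros)
  hence "doubling_factor e analytic_on A"
    using analytic_on_holomorphic by blast
  thus ?thesis by (rule analytic_on_imp_meromorphic_on)
qed

lemma meromorphic_zeta_upto:
  "symbol e b \<Longrightarrow> zeta_upto N e b meromorphic_on {s. Re s > (e + real CARD('p) - real N) / D}"
proof (induction N arbitrary: e b)
  case 0
  have "open {s. Re s > (e + real CARD('p)) / D}"
    by (simp add: open_halfspace_Re_gt)
  hence "(\<lambda>s. infsum (summand b s) UNIV) analytic_on {s. Re s > (e + real CARD('p)) / D}"
    using holomorphic_infsum_summand[OF symbol_has_order[OF 0]] analytic_on_open by blast
  thus ?case
    by (simp add: analytic_on_imp_meromorphic_on)
next
  case (Suc N)
  have "zeta_upto N (e - 1) (twist e A b) meromorphic_on {s. Re s > (e + real CARD('p) - real (Suc N)) / D}" for A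
    using Suc.IH[OF symbol_twist[OF Suc.prems]] by (simp add: algebra_simps)
  hence "(\<lambda>s. (\<Sum>A\<in>UNIV. zeta_upto N (e - 1) (twist e A b) s) / doubling_factor e s)
      meromorphic_on {s. Re s > (e + real CARD('p) - real (Suc N)) / D}"
    by (intro meromorphic_intros meromorphic_doubling_factor)
  thus ?case by simp
qed

text \<open>The depth is chosen so large that its half-plane contains \<open>s\<close>. Depths valid
  at the same point agree there, so the pieces glue to one function.\<close>

definition zeta :: "real \<Rightarrow> (complex \<Rightarrow> ('p \<Rightarrow> nat) \<Rightarrow> complex) \<Rightarrow> complex \<Rightarrow> complex"
  where "zeta e b s = zeta_upto (nat \<lfloor>e + real CARD('p) - D * Re s\<rfloor> + 1) e b s"

lemma zeta_eq:
  assumes "symbol e b" "Re s > (e + real CARD('p) - real N) / D"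
  shows "zeta e b s = zeta_upto N e b s"
proof -
  define M where "M = nat \<lfloor>e + real CARD('p) - D * Re s\<rfloor> + 1"
  have "e + real CARD('p) - D * Re s < M"
    unfolding M_def by linarith
  hence M: "Re s > (e + real CARD('p) - real M) / D"
    using D_pos by (simp add: field_simps)
  show ?thesis
    unfolding zeta_def M_def[symmetric]
    using zeta_upto_eq[OF assms(1) M, of "max M N"] zeta_upto_eq[OF assms, of "max M N"] by simp
qed

lemma eventually_zeta_eq:
  assumes "symbol e b" "Re z > (e + real CARD('p) - real N) / D"
  shows "eventually (\<lambda>s. zeta e b s = zeta_upto N e b s) (at z)"
proof -
  have "eventually (\<lambda>s. s \<in> {s. Re s > (e + real CARD('p) - real N) / D}) (at z)"
    using assms(2) by (intro eventually_at_in_open') (auto simp: open_halfspace_Re_gt)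
  thus ?thesis
    by eventually_elim (use zeta_eq[OF assms(1)] in auto)
qed

lemma meromorphic_zeta:
  assumes "symbol e b"
  shows "zeta e b meromorphic_on UNIV"
proof (subst meromorphic_on_meromorphic_at, safe)
  fix z
  obtain N :: nat where "e + real CARD('p) - D * Re z < N"
    using reals_Archimedean2 by blast
  hence N: "Re z > (e + real CARD('p) - real N) / D"
    using D_pos by (simp add: field_simps)
  hence "zeta_upto N e b meromorphic_on {z}"
    by (intro meromorphic_on_subset[OF meromorphic_zeta_upto[OF assms]]) auto
  moreover have "zeta e b meromorphic_on {z} \<longleftrightarrow> zeta_upto N e b meromorphic_on {z}"
    by (intro meromorphic_on_cong) (use eventually_zeta_eq[OF assms N] in auto)
  ultimately show "zeta e b meromorphic_on {z}"
    by simp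
qed

end

section \<open>Residues and values at zero\<close>

text \<open>\<open>residue_upto N e a / D\<close> is the residue at \<open>s = 0\<close> of the continued series with
  amplitude \<open>a\<close> of order \<open>e < N - CARD('p)\<close>; the definition does not involve \<open>\<Lambda>\<close>.\<close>

primrec residue_upto :: "nat \<Rightarrow> real \<Rightarrow> (('p::finite \<Rightarrow> nat) \<Rightarrow> complex) \<Rightarrow> complex"
  where
    "residue_upto 0 e a = 0"
  | "residue_upto (Suc N) e a =
      (if e = - real CARD('p)
       then (\<Sum>A\<in>UNIV. infsum (\<lambda>k. a (dbl A k) - of_real (2 powr e) * a k) UNIV) / of_real (ln 2)
       else (\<Sum>A\<in>UNIV. residue_upto N (e - 1) (\<lambda>k. a (dbl A k) - of_real (2 powr e) * a k))
              / (1 - of_real (2 powr (real CARD('p) + e))))"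

text \<open>Polynomial functions of degree less than \<open>n\<close>.\<close>

primrec dyadic_poly :: "nat \<Rightarrow> (('p::finite \<Rightarrow> nat) \<Rightarrow> complex) \<Rightarrow> bool"
  where
    "dyadic_poly 0 g \<longleftrightarrow> (\<forall>k. g k = 0)"
  | "dyadic_poly (Suc n) g \<longleftrightarrow> (\<exists>C. \<forall>k. norm (g k) \<le> C * wt k powr real n) \<and>
      (\<forall>A. dyadic_poly n (\<lambda>k. g (dbl A k) - 2 ^ n * g k))"

text \<open>\<open>D\<close> times the value at \<open>s = 0\<close> of the continued series, where \<open>l = log_increment \<Lambda> D\<close>.\<close>

primrec value_at_zero ::
    "nat \<Rightarrow> (('p::finite \<Rightarrow> nat) \<Rightarrow> complex) \<Rightarrow> ('p set \<Rightarrow> ('p \<Rightarrow> nat) \<Rightarrow> complex) \<Rightarrow> complex"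
  where
    "value_at_zero 0 g l = 0"
  | "value_at_zero (Suc n) g l =
      ((\<Sum>A\<in>UNIV. value_at_zero n (\<lambda>k. g (dbl A k) - 2 ^ n * g k) l)
       - (\<Sum>A\<in>UNIV. residue_upto (n + CARD('p)) (real n - 1) (\<lambda>k. g (dbl A k) * l A k)))
      / (1 - 2 ^ (CARD('p) + n))"

lemma dyadic_poly_symbol: "dyadic_poly n g \<Longrightarrow> symbol (real n - 1) (\<lambda>_. g)"
proof -
  have "dyadic_poly n g \<Longrightarrow> symbol_upto N (real n - 1) (\<lambda>_. g)" for N
  proof (induction N arbitrary: n g)
    case 0
    show ?case
    proof (cases n)
      case 0
      hence "g = (\<lambda>_. 0)" using \<open>dyadic_poly n g\<close> by auto
      thus ?thesis by (simp add: symbol_upto_has_order[OF symbol_upto_zero])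
    next
      case (Suc m)
      then obtain C where "\<And>k. norm (g k) \<le> C * wt k powr (real n - 1)"
        using 0 by auto
      thus ?thesis by (auto intro!: has_orderI)
    qed
  next
    case (Suc N)
    show ?case
    proof (cases n)
      case 0
      hence "g = (\<lambda>_. 0)" using \<open>dyadic_poly n g\<close> by auto
      thus ?thesis by (simp only: symbol_upto_zero)
    next
      case (Suc m)
      then obtain C where "\<And>k. norm (g k) \<le> C * wt k powr (real n - 1)"
        using \<open>dyadic_poly n g\<close> by auto
      hence "has_order (real n - 1) (\<lambda>_. g)" by (auto intro!: has_orderI)
      moreover have "symbol_upto N (real m - 1) (\<lambda>s k. g (dbl A k) - 2 ^ m * g k)" for A
        using Suc \<open>dyadic_poly n g\<close> by (intro Suc.IH) auto
      ultimately show ?thesis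
        using Suc by (simp add: powr_realpow)
    qed
  qed
  thus "dyadic_poly n g \<Longrightarrow> symbol (real n - 1) (\<lambda>_. g)"
    by (simp add: symbol_def)
qed

lemma summable_order_less:
  assumes "has_order e (\<lambda>_. a)" "e < - real CARD('p)"
  shows "(a :: ('p::finite \<Rightarrow> nat) \<Rightarrow> complex) summable_on UNIV"
proof -
  obtain C where C: "\<And>k. norm (a k) \<le> C * wt k powr e"
    using has_orderE[OF assms(1), of 0] by (metis norm_zero order_refl)
  have "(\<lambda>k :: 'p \<Rightarrow> nat. C * wt k powr (- (- e))) summable_on UNIV"
    using assms(2) by (intro summable_on_cmult_right summable_wt_powr) auto
  thus ?thesis
    by (rule abs_summable_summable[OF Infinite_Sum.abs_summable_on_comparison_test']) (use C in auto)
qed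

lemma residue_upto_zero: "residue_upto N e (\<lambda>_. 0) = 0"
  by (induction N arbitrary: e) auto

text \<open>At the critical order \<open>e = - p\<close> infinite sums have to be split. The
  differences of symbols have order \<open>- p - 1\<close> there, so these sums converge
  absolutely.\<close>

lemma residue_upto_add:
  "symbol e (\<lambda>_. a) \<Longrightarrow> symbol e (\<lambda>_. b) \<Longrightarrow>
     residue_upto N e (\<lambda>k. a k + b k) = residue_upto N e a + residue_upto N e b"
proof (induction N arbitrary: e a b)
  case (Suc N)
  let ?\<Delta> = "\<lambda>A c k. c (dbl A k) - of_real (2 powr e) * c k :: complex"
  have \<Delta>: "symbol (e - 1) (\<lambda>_. ?\<Delta> A a)" "symbol (e - 1) (\<lambda>_. ?\<Delta> A b)" for A
    using symbol_dbl_diff[OF Suc.prems(1)] symbol_dbl_diff[OF Suc.prems(2)] by auto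
  have split: "?\<Delta> A (\<lambda>k. a k + b k) = (\<lambda>k. ?\<Delta> A a k + ?\<Delta> A b k)" for A
    by (simp add: algebra_simps fun_eq_iff)
  show ?case
  proof (cases "e = - real CARD('a)")
    case True
    have "?\<Delta> A a summable_on UNIV" "?\<Delta> A b summable_on UNIV" for A
      using \<Delta>[of A] True by (auto intro!: summable_order_less[of "e - 1"] symbol_has_order)
    thus ?thesis
      using True unfolding residue_upto.simps split
      by (simp add: infsum_add sum.distrib add_divide_distrib)
  next
    case False
    thus ?thesis
      unfolding residue_upto.simps split
      by (simp add: Suc.IH[OF \<Delta>] sum.distrib add_divide_distrib)
  qed
qed simp

lemma residue_upto_sum:
  assumes "\<And>j. j \<in> J \<Longrightarrow> symbol e (\<lambda>_. a j)"
  shows "residue_upto N e (\<lambda>k. \<Sum>j\<in>J. a j k) = (\<Sum>j\<in>J. residue_upto N e (a j))"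
  using assms
proof (induction J rule: infinite_finite_induct)
  case (insert j J)
  have "symbol e (\<lambda>_ k. \<Sum>j\<in>J. a j k)"
    using insert symbol_sum[of J e "\<lambda>j _. a j"] by auto
  thus ?case
    using insert by (simp add: residue_upto_add)
qed (auto simp: residue_upto_zero)

lemma dyadic_poly_Suc_sub: "dyadic_poly (Suc n) g \<Longrightarrow> dyadic_poly n (\<lambda>k. g (dbl A k) - 2 ^ n * g k)"
  by simp

lemma dyadic_poly_dbl_symbol:
  assumes "dyadic_poly (Suc n) g" "symbol (- 1) b"
  shows "symbol (real n - 1) (\<lambda>s k. g (dbl A k) * b s k)"
proof -
  have "symbol (real n) (\<lambda>_. g)"
    using dyadic_poly_symbol[OF assms(1)] by simp
  thus ?thesis
    using symbol_mult[OF symbol_dbl assms(2), of "real n" "\<lambda>_. g" A] by simp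
qed

text \<open>Each level meets \<open>l\<close> once, as a linear factor inside a residue; the rest of
  the level passes the same \<open>l\<close> on to a polynomial of lower degree. Products of
  increments never occur.\<close>

lemma value_at_zero_sum:
  assumes l: "\<And>j A. j \<in> J \<Longrightarrow> symbol (- 1) (\<lambda>_. l j A)"
  shows "dyadic_poly n g \<Longrightarrow>
    value_at_zero n g (\<lambda>A k. \<Sum>j\<in>J. l j A k) = (\<Sum>j\<in>J. value_at_zero n g (l j))"
proof (induction n arbitrary: g)
  case (Suc n)
  have "residue_upto (n + CARD('b)) (real n - 1) (\<lambda>k. g (dbl A k) * (\<Sum>j\<in>J. l j A k)) =
      (\<Sum>j\<in>J. residue_upto (n + CARD('b)) (real n - 1) (\<lambda>k. g (dbl A k) * l j A k))" for A
    unfolding sum_distrib_left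
    by (intro residue_upto_sum dyadic_poly_dbl_symbol[OF Suc.prems] l)
  moreover have "value_at_zero n (\<lambda>k. g (dbl A k) - 2 ^ n * g k) (\<lambda>A k. \<Sum>j\<in>J. l j A k) =
      (\<Sum>j\<in>J. value_at_zero n (\<lambda>k. g (dbl A k) - 2 ^ n * g k) (l j))" for A
    by (intro Suc.IH dyadic_poly_Suc_sub Suc.prems)
  ultimately show ?case
    by (simp add: sum_divide_distrib[symmetric] sum_subtractf sum.swap[of _ J])
qed simp

section \<open>Limits of the continued series at zero\<close>

context log_symbol
begin

lemma zeta_upto_add_mult:
  assumes "h holomorphic_on UNIV"
  shows "symbol e a \<Longrightarrow> symbol e b \<Longrightarrow> Re s > (e + real CARD('p) - real N) / D \<Longrightarrow>
    zeta_upto N e (\<lambda>s k. a s k + h s * b s k) s = zeta_upto N e a s + h s * zeta_upto N e b s"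
proof (induction N arbitrary: e a b)
  case 0
  hence "summand a s summable_on UNIV" "summand b s summable_on UNIV"
    by (auto intro: summable_summand symbol_has_order)
  moreover have "summand (\<lambda>s k. a s k + h s * b s k) s = (\<lambda>k. summand a s k + h s * summand b s k)"
    by (simp add: summand_def fun_eq_iff algebra_simps)
  ultimately show ?case
    by (simp add: infsum_add infsum_cmult_right summable_on_cmult_right)
next
  case (Suc N)
  have "twist e A (\<lambda>s k. a s k + h s * b s k) = (\<lambda>s k. twist e A a s k + h s * twist e A b s k)" for A
    by (simp add: twist_def fun_eq_iff algebra_simps)
  moreover have "zeta_upto N (e - 1) (\<lambda>s k. twist e A a s k + h s * twist e A b s k) s =
      zeta_upto N (e - 1) (twist e A a) s + h s * zeta_upto N (e - 1) (twist e A b) s" for A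
    using Suc.prems by (intro Suc.IH symbol_twist) (auto simp: algebra_simps)
  ultimately show ?case
    by (simp add: sum.distrib sum_distrib_left[symmetric] add_divide_distrib)
qed

lemma zeta_upto_zero: "zeta_upto N e (\<lambda>_ _. 0) s = 0"
proof (induction N arbitrary: e)
  case 0
  have "summand (\<lambda>_ _. 0) s = (\<lambda>_. 0)" by (simp add: summand_def fun_eq_iff)
  thus ?case by simp
next
  case (Suc N)
  have "twist e A (\<lambda>_ _. 0) = (\<lambda>_ _. 0)" for A
    by (simp add: twist_def fun_eq_iff)
  thus ?case using Suc.IH by simp
qed

lemma doubling_factor_at_0:
  "(doubling_factor e \<longlongrightarrow> 1 - of_real (2 powr (real CARD('p) + e))) (at 0)"
  unfolding doubling_factor_def by (auto intro!: tendsto_eq_intros)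

text \<open>At this order the constant \<open>2 powr (p + e)\<close> is 1, so the doubling factor
  has a simple zero at 0 with derivative \<open>D * ln 2\<close>.\<close>

lemma critical_doubling_factor_at_0:
  "((\<lambda>s. s / doubling_factor (- real CARD('p)) s) \<longlongrightarrow> 1 / of_real (D * ln 2)) (at 0)"
proof -
  have "((\<lambda>s. exp (s * complex_of_real (D * ln 2))) has_field_derivative of_real (D * ln 2)) (at 0)"
    by (auto intro!: derivative_eq_intros)
  hence "((\<lambda>s. (exp (s * complex_of_real (D * ln 2)) - 1) / s) \<longlongrightarrow> of_real (D * ln 2)) (at 0)"
    by (simp add: has_field_derivative_iff)
  hence "((\<lambda>s. 1 / ((exp (s * complex_of_real (D * ln 2)) - 1) / s)) \<longlongrightarrow> 1 / of_real (D * ln 2)) (at 0)"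
    using D_pos by (intro tendsto_divide tendsto_const) auto
  thus ?thesis
    by (simp add: doubling_factor_def)
qed

lemma zeta_upto_0_tendsto:
  assumes "symbol e b" "e + real CARD('p) < 0"
  shows "(zeta_upto 0 e b \<longlongrightarrow> zeta_upto 0 e b 0) (at 0)"
proof -
  let ?H = "{s. Re s > (e + real CARD('p)) / D}"
  have "continuous_on ?H (\<lambda>s. infsum (summand b s) UNIV)"
    by (intro holomorphic_on_imp_continuous_on holomorphic_infsum_summand symbol_has_order assms)
  moreover have "open ?H" "0 \<in> ?H"
    using assms(2) D_pos by (auto simp: open_halfspace_Re_gt divide_neg_pos)
  ultimately show ?thesis
    by (auto simp: continuous_on_eq_continuous_at isCont_def zeta_upto.simps(1)[abs_def])
qed

text \<open>Below order \<open>- p\<close> the original series converges around 0, and every depth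
  agrees with it there.\<close>

lemma zeta_upto_tendsto:
  assumes "symbol e b" "e + real CARD('p) < 0"
  shows "(zeta_upto N e b \<longlongrightarrow> zeta_upto 0 e b 0) (at 0)"
proof -
  have "eventually (\<lambda>s. s \<in> {s. Re s > (e + real CARD('p) - real 0) / D}) (at 0)"
    using assms(2) D_pos by (intro eventually_at_in_open') (auto simp: open_halfspace_Re_gt divide_neg_pos)
  hence "eventually (\<lambda>s. zeta_upto 0 e b s = zeta_upto N e b s) (at 0)"
    by eventually_elim (use zeta_upto_eq[OF assms(1), of 0 _ N] in auto)
  thus ?thesis
    using zeta_upto_0_tendsto[OF assms] by (rule Lim_transform_eventually[rotated])
qed

text \<open>Only \<open>b 0\<close> survives: at \<open>s = 0\<close> the exponential in
  \<open>twist\<close> is 1, so the recursion for the limit never meets \<open>\<Lambda>\<close>.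
  The number \<open>D\<close> enters once, through the simple zero at the critical order.\<close>

lemma residue_zeta_upto:
  "symbol e b \<Longrightarrow> e + real CARD('p) < real N \<Longrightarrow>
    ((\<lambda>s. s * zeta_upto N e b s) \<longlongrightarrow> residue_upto N e (b 0) / of_real D) (at 0)"
proof (induction N arbitrary: e b)
  case 0
  have "((\<lambda>s. s * zeta_upto 0 e b s) \<longlongrightarrow> 0 * zeta_upto 0 e b 0) (at 0)"
    using 0 by (intro tendsto_mult zeta_upto_0_tendsto) auto
  thus ?case by simp
next
  case (Suc N)
  have T0: "twist e A b 0 = (\<lambda>k. b 0 (dbl A k) - of_real (2 powr e) * b 0 k)" for A
    by (simp add: twist_def fun_eq_iff)
  show ?case
  proof (cases "e = - real CARD('p)")
    case True
    \<comment> \<open>The twisted amplitudes have order \<open>- p - 1\<close>, so their series are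
      regular at 0 and the pole comes from the doubling factor alone.\<close>
    have "((\<lambda>s. (s / doubling_factor e s) * (\<Sum>A\<in>UNIV. zeta_upto N (e - 1) (twist e A b) s)) \<longlongrightarrow>
        (1 / of_real (D * ln 2)) * (\<Sum>A\<in>UNIV. zeta_upto 0 (e - 1) (twist e A b) 0)) (at 0)"
      unfolding True
      by (intro tendsto_mult critical_doubling_factor_at_0 tendsto_sum zeta_upto_tendsto
          symbol_twist Suc.prems(1)[unfolded True]) auto
    moreover have "summand (twist e A b) 0 = twist e A b 0" for A
      by (simp add: summand_def fun_eq_iff)
    ultimately show ?thesis
      using True by (simp add: T0[unfolded True] mult.commute)
  next
    case False
    have "2 powr (real CARD('p) + e) \<noteq> 1"
      using False by simp
    hence nz: "1 - complex_of_real (2 powr (real CARD('p) + e)) \<noteq> 0"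
      by (metis eq_iff_diff_eq_0 of_real_eq_1_iff)
    have "((\<lambda>s. (\<Sum>A\<in>UNIV. s * zeta_upto N (e - 1) (twist e A b) s) / doubling_factor e s) \<longlongrightarrow>
        (\<Sum>A\<in>UNIV. residue_upto N (e - 1) (twist e A b 0) / of_real D) /
        (1 - of_real (2 powr (real CARD('p) + e)))) (at 0)"
      using Suc.prems
      by (intro tendsto_divide[OF _ doubling_factor_at_0 nz] tendsto_sum Suc.IH symbol_twist) auto
    thus ?thesis
      using False by (simp add: T0 sum_distrib_left[symmetric] sum_divide_distrib[symmetric] mult.commute[of "of_real D"])
  qed
qed

text \<open>The depth \<open>n + p\<close> at order \<open>n - 1\<close> reaches down to
  \<open>Re s > - 1 / D\<close>, hence past 0. The doubling factor tends to 1 - 2^(p+n), which is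
  nonzero, and the amplitude containing the increment carries a factor \<open>s\<close>, so a simple
  pole of its series becomes a finite contribution.\<close>

lemma zeta_upto_dyadic_poly_tendsto:
  "dyadic_poly n g \<Longrightarrow>
    (zeta_upto (n + CARD('p)) (real n - 1) (\<lambda>_. g) \<longlongrightarrow>
       value_at_zero n g (log_increment \<Lambda> D) / of_real D) (at 0)"
proof (induction n arbitrary: g)
  case 0
  hence "g = (\<lambda>_. 0)" by (simp add: fun_eq_iff)
  hence "zeta_upto N e (\<lambda>_. g) = (\<lambda>_. 0)" for N e
    by (simp add: zeta_upto_zero ext)
  thus ?case by simp
next
  case (Suc n)
  \<comment> \<open>\<open>\<psi> z\<close> is (exp z - 1) / z, extended by 1 at 0. It gives an
    exact first-order expansion exp(-s h) = 1 - s h \<psi>(-s h): higher powers of \<open>s\<close>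
    are kept inside the amplitude \<open>b\<close>, of which only the value at \<open>s = 0\<close>
    affects the limit.\<close>
  define \<psi> where "\<psi> = (\<lambda>z. if z = 0 then deriv exp 0 else (exp z - exp 0) / (z - 0) :: complex)"
  define N where "N = n + CARD('p)"
  define b where "b = (\<lambda>A s k. g (dbl A k) * (log_increment \<Lambda> D A k * \<psi> (- s * log_increment \<Lambda> D A k)))"
  define d where "d = (\<lambda>A k. g (dbl A k) - 2 ^ n * g k)"
  have twist: "twist (real n) A (\<lambda>_. g) = (\<lambda>s k. d A k + (- s) * b A s k)" for A
  proof (intro ext)
    fix s k
    have "z * \<psi> z = exp z - 1" for z
      by (simp add: \<psi>_def)
    from this[of "- s * log_increment \<Lambda> D A k"]
    have exp: "exp (- s * log_increment \<Lambda> D A k) = 1 - s * log_increment \<Lambda> D A k * \<psi> (- s * log_increment \<Lambda> D A k)"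
      by (simp add: algebra_simps)
    thus "twist (real n) A (\<lambda>_. g) s k = d A k + (- s) * b A s k"
      unfolding twist_def b_def d_def exp by (simp add: powr_realpow algebra_simps)
  qed
  have u: "symbol (- 1) (\<lambda>s k. - s * log_increment \<Lambda> D A k)" for A
    by (rule symbol_entire_mult[OF holomorphic_on_minus[OF holomorphic_on_ident] symbol_increment])
  have "\<psi> holomorphic_on UNIV"
    unfolding \<psi>_def by (rule pole_lemma_open) (auto intro: holomorphic_intros)
  hence "symbol 0 (\<lambda>s k. \<psi> (- s * log_increment \<Lambda> D A k))" for A
    by (rule symbol_compose[OF open_UNIV UNIV_I u])
       (rule entire_range_compact[OF symbol_has_order[OF u]], simp)
  hence "symbol (- 1 + 0) (\<lambda>s k. log_increment \<Lambda> D A k * \<psi> (- s * log_increment \<Lambda> D A k))" for A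
    by (rule symbol_mult[OF symbol_increment])
  hence sym_b: "symbol (real n - 1) (b A)" for A
    unfolding b_def by (intro dyadic_poly_dbl_symbol Suc.prems) simp
  have poly_d: "dyadic_poly n (d A)" for A
    unfolding d_def by (rule dyadic_poly_Suc_sub[OF Suc.prems])
  have sym_d: "symbol (real n - 1) (\<lambda>_. d A)" for A
    by (rule dyadic_poly_symbol[OF poly_d])
  have "\<psi> 0 = 1"
    using DERIV_imp_deriv[OF DERIV_exp[of "0 :: complex"]] by (simp add: \<psi>_def)
  hence b0: "b A 0 = (\<lambda>k. g (dbl A k) * log_increment \<Lambda> D A k)" for A
    by (simp add: b_def fun_eq_iff)
  have lim: "((\<lambda>s. (\<Sum>A\<in>UNIV. zeta_upto N (real n - 1) (\<lambda>_. d A) s - s * zeta_upto N (real n - 1) (b A) s)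
        / doubling_factor (real n) s) \<longlongrightarrow>
      (\<Sum>A\<in>UNIV. value_at_zero n (d A) (log_increment \<Lambda> D) / of_real D
        - residue_upto N (real n - 1) (b A 0) / of_real D)
      / (1 - of_real (2 powr (real CARD('p) + real n)))) (at 0)"
  proof (intro tendsto_divide[OF _ doubling_factor_at_0] tendsto_sum tendsto_diff)
    fix A
    show "(zeta_upto N (real n - 1) (\<lambda>_. d A) \<longlongrightarrow> value_at_zero n (d A) (log_increment \<Lambda> D) / of_real D) (at 0)"
      unfolding N_def by (rule Suc.IH[OF poly_d])
    show "((\<lambda>s. s * zeta_upto N (real n - 1) (b A) s) \<longlongrightarrow> residue_upto N (real n - 1) (b A 0) / of_real D) (at 0)"
      by (rule residue_zeta_upto[OF sym_b]) (simp add: N_def)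
  next
    have "real CARD('p) + real n > 0"
      by (intro add_pos_nonneg) auto
    hence "2 powr (real CARD('p) + real n) \<noteq> 1"
      by simp
    thus "1 - complex_of_real (2 powr (real CARD('p) + real n)) \<noteq> 0"
      by (metis eq_iff_diff_eq_0 of_real_eq_1_iff)
  qed
  have "eventually (\<lambda>s. s \<in> {s. Re s > (real n - 1 + real CARD('p) - real N) / D}) (at 0)"
    using D_pos by (intro eventually_at_in_open') (auto simp: open_halfspace_Re_gt N_def divide_neg_pos)
  hence "eventually (\<lambda>s. (\<Sum>A\<in>UNIV. zeta_upto N (real n - 1) (\<lambda>_. d A) s - s * zeta_upto N (real n - 1) (b A) s)
        / doubling_factor (real n) s = zeta_upto (Suc N) (real n) (\<lambda>_. g) s) (at 0)"
  proof eventually_elim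
    case (elim s)
    have "zeta_upto N (real n - 1) (\<lambda>s k. d A k + (- s) * b A s k) s =
        zeta_upto N (real n - 1) (\<lambda>_. d A) s + (- s) * zeta_upto N (real n - 1) (b A) s" for A
      using elim by (intro zeta_upto_add_mult sym_d sym_b) (auto intro: holomorphic_intros)
    thus ?case by (simp add: twist)
  qed
  from Lim_transform_eventually[OF lim this]
  have "(zeta_upto (Suc N) (real n) (\<lambda>_. g) \<longlongrightarrow>
      (\<Sum>A\<in>UNIV. value_at_zero n (d A) (log_increment \<Lambda> D) / of_real D
        - residue_upto N (real n - 1) (b A 0) / of_real D)
      / (1 - of_real (2 powr (real CARD('p) + real n)))) (at 0)" .
  moreover have "complex_of_real (2 powr (real CARD('p) + real n)) = 2 ^ (CARD('p) + n)"
    by (simp add: powr_realpow flip: of_nat_add)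
  ultimately show ?case
    by (simp add: N_def b0 d_def sum_subtractf sum_divide_distrib[symmetric] diff_divide_distrib
        mult.commute[of "of_real D"] del: zeta_upto.simps)
qed

theorem dyadic_poly_continuation:
  assumes "dyadic_poly n g"
  obtains Z where "Z nicely_meromorphic_on UNIV"
    "\<And>s. Re s > (real n - 1 + real CARD('p)) / D \<Longrightarrow> ((\<lambda>k. g k * exp (- s * \<Lambda> k)) has_sum Z s) UNIV"
    "of_real D * Z 0 = value_at_zero n g (log_increment \<Lambda> D)"
proof -
  let ?e = "real n - 1"
  let ?Z = "zeta ?e (\<lambda>_. g)"
  have g: "symbol ?e (\<lambda>_. g)" by (rule dyadic_poly_symbol[OF assms])
  show ?thesis
  \<comment> \<open>At zeros of doubling factors the recursion divides by 0, so its values there are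
    arbitrary; removing singularities restores the limits at removable points.\<close>
  proof (rule that[of "remove_sings ?Z"])
    show "remove_sings ?Z nicely_meromorphic_on UNIV"
      by (intro remove_sings_nicely_meromorphic meromorphic_zeta g)
  next
    fix s :: complex
    let ?H = "{s. Re s > (?e + real CARD('p)) / D}"
    assume s: "Re s > (?e + real CARD('p)) / D"
    have "open ?H" by (simp add: open_halfspace_Re_gt)
    have "infsum (summand (\<lambda>_. g) z) UNIV = ?Z z" if "z \<in> ?H" for z
      using zeta_eq[OF g, of 0 z] that by simp
    hence "?Z holomorphic_on ?H"
      using holomorphic_infsum_summand[OF symbol_has_order[OF g]] by (rule holomorphic_transform[rotated])
    hence "?Z analytic_on {s}"
      using s \<open>open ?H\<close> analytic_at by blast
    hence "remove_sings ?Z s = infsum (summand (\<lambda>_. g) s) UNIV"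
      using zeta_eq[OF g, of 0 s] s by simp
    thus "((\<lambda>k. g k * exp (- s * \<Lambda> k)) has_sum remove_sings ?Z s) UNIV"
      using summable_summand[OF symbol_has_order[OF g] s] by (simp add: summand_def[abs_def])
  next
    have "eventually (\<lambda>s. ?Z s = zeta_upto (n + CARD('p)) ?e (\<lambda>_. g) s) (at 0)"
      by (rule eventually_zeta_eq[OF g]) (use D_pos in \<open>auto simp: divide_neg_pos\<close>)
    hence "(?Z \<longlongrightarrow> value_at_zero n g (log_increment \<Lambda> D) / of_real D) (at 0)"
      using zeta_upto_dyadic_poly_tendsto[OF assms] by (simp add: filterlim_cong)
    hence "remove_sings ?Z 0 = value_at_zero n g (log_increment \<Lambda> D) / of_real D"
      by (rule remove_sings_eqI)
    thus "of_real D * remove_sings ?Z 0 = value_at_zero n g (log_increment \<Lambda> D)"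
      using D_pos by simp
  qed
qed

end

section \<open>Polynomials on the orthant\<close>

lemma eval_mpoly_add: "eval_mpoly (f + g) x = eval_mpoly f x + eval_mpoly g x"
  unfolding eval_mpoly_def
  by (rule setsum_keys_plus_distrib[where f = "\<lambda>m c. c * (\<Prod>i\<in>UNIV. x i ^ Poly_Mapping.lookup m i)" for x])
     (auto simp: algebra_simps)

lemma eval_mpoly_single: "eval_mpoly (Poly_Mapping.single m c) x = c * (\<Prod>i\<in>UNIV. x i ^ Poly_Mapping.lookup m i)"
  by (simp add: eval_mpoly_def)

lemma eval_mpoly_sum: "eval_mpoly (\<Sum>j\<in>J. f j) x = (\<Sum>j\<in>J. eval_mpoly (f j) x)"
  by (induction J rule: infinite_finite_induct) (auto simp: eval_mpoly_add eval_mpoly_def[of 0])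

lemma mpoly_eq_sum_single: "f = (\<Sum>m\<in>Poly_Mapping.keys f. Poly_Mapping.single m (Poly_Mapping.lookup f m))"
  by (rule poly_mapping_eqI) (auto simp: lookup_sum lookup_single when_def in_keys_iff)

lemma eval_mpoly_mult: "eval_mpoly (f * g) x = eval_mpoly f x * eval_mpoly g x"
proof -
  have "f * g = (\<Sum>m\<in>Poly_Mapping.keys f. Poly_Mapping.single m (Poly_Mapping.lookup f m)) *
      (\<Sum>m\<in>Poly_Mapping.keys g. Poly_Mapping.single m (Poly_Mapping.lookup g m))"
    using mpoly_eq_sum_single[of f] mpoly_eq_sum_single[of g] by simp
  also have "\<dots> = (\<Sum>m\<in>Poly_Mapping.keys f. \<Sum>m'\<in>Poly_Mapping.keys g. Poly_Mapping.single (m + m') (Poly_Mapping.lookup f m * Poly_Mapping.lookup g m'))"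
    by (simp add: sum_product mult_single)
  finally show ?thesis
    by (simp add: eval_mpoly_sum eval_mpoly_single)
       (simp add: eval_mpoly_def sum_product lookup_add power_add prod.distrib algebra_simps)
qed

lemma eval_mpoly_1: "eval_mpoly 1 x = 1"
  by (simp add: eval_mpoly_single flip: single_one)

lemma eval_real_prod: "eval_real (\<Prod>j\<in>J. f j) x = (\<Prod>j\<in>J. eval_real (f j) x)"
  unfolding eval_real_def
  by (induction J rule: infinite_finite_induct) (auto simp: eval_mpoly_mult eval_mpoly_1)

lemma monom_degree_le: "m \<in> Poly_Mapping.keys f \<Longrightarrow> monom_degree m \<le> total_degree f"
  unfolding total_degree_def by (intro Max_ge) auto

lemma total_degree_le: "(\<And>m. m \<in> Poly_Mapping.keys f \<Longrightarrow> monom_degree m \<le> d) \<Longrightarrow> total_degree f \<le> d"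
  unfolding total_degree_def by (intro Max.boundedI) auto

lemma total_degree_mult_le:
  fixes f g :: "('p::finite, 'a::semiring_0) mpoly"
  shows "total_degree (f * g) \<le> total_degree f + total_degree g"
proof (rule total_degree_le)
  fix m assume "m \<in> Poly_Mapping.keys (f * g)"
  then obtain a b where "m = a + b" "a \<in> Poly_Mapping.keys f" "b \<in> Poly_Mapping.keys g"
    using Poly_Mapping.keys_mult[of f g] by auto
  thus "monom_degree m \<le> total_degree f + total_degree g"
    using monom_degree_le[of a f] monom_degree_le[of b g]
    by (simp add: monom_degree_def lookup_add sum.distrib)
qed

lemma total_degree_prod_le:
  fixes f :: "'j \<Rightarrow> ('p::finite, 'a::comm_semiring_1) mpoly"
  shows "total_degree (\<Prod>j\<in>J. f j) \<le> (\<Sum>j\<in>J. total_degree (f j))"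
proof -
  have one: "total_degree (1 :: ('p, 'a) mpoly) = 0"
    by (simp add: total_degree_def monom_degree_def)
  show ?thesis
    by (induction J rule: infinite_finite_induct)
       (auto simp: one intro: order_trans[OF total_degree_mult_le])
qed

text \<open>Induction over polynomial functions for an arbitrary property graded by degree. It
  serves twice: for doubling differences on the lattice and for dilations of the orthant.\<close>

lemma eval_real_closure:
  fixes P :: "nat \<Rightarrow> (real ^ 'p::finite \<Rightarrow> complex) \<Rightarrow> bool"
  assumes const: "\<And>c. P 0 (\<lambda>_. c)"
    and coord: "\<And>i. P 1 (\<lambda>x. of_real (x $ i))"
    and add: "\<And>d a b. P d a \<Longrightarrow> P d b \<Longrightarrow> P d (\<lambda>x. a x + b x)"
    and mult: "\<And>d e a b. P d a \<Longrightarrow> P e b \<Longrightarrow> P (d + e) (\<lambda>x. a x * b x)"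
    and mono: "\<And>d a. P d a \<Longrightarrow> P (Suc d) a"
    and deg: "total_degree f \<le> d"
  shows "P d (eval_real f)"
proof -
  have power: "P n (\<lambda>x. of_real (x $ i) ^ n)" for i n
    by (induction n) (use const[of 1] mult[OF coord] in auto)
  have prod: "P (\<Sum>i\<in>I. Poly_Mapping.lookup m i) (\<lambda>x. \<Prod>i\<in>I. of_real (x $ i) ^ Poly_Mapping.lookup m i)" for m and I :: "'p set"
    by (induction I rule: infinite_finite_induct) (use const[of 1] mult[OF power] in auto)
  have mono': "P d' a" if "P d a" "d \<le> d'" for d d' a
    using that(2) by (induction rule: dec_induct) (use that(1) mono in auto)
  have monom: "P d (\<lambda>x. Poly_Mapping.lookup f m * (\<Prod>i\<in>UNIV. of_real (x $ i) ^ Poly_Mapping.lookup m i))" if "m \<in> Poly_Mapping.keys f" for m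
  proof (rule mono')
    show "P (0 + (\<Sum>i\<in>UNIV. Poly_Mapping.lookup m i)) (\<lambda>x. Poly_Mapping.lookup f m * (\<Prod>i\<in>UNIV. of_real (x $ i) ^ Poly_Mapping.lookup m i))"
      by (intro mult const prod)
    show "0 + (\<Sum>i\<in>UNIV. Poly_Mapping.lookup m i) \<le> d"
      using monom_degree_le[OF that] deg by (simp add: monom_degree_def)
  qed
  have "P d (\<lambda>x. \<Sum>m\<in>K. Poly_Mapping.lookup f m * (\<Prod>i\<in>UNIV. of_real (x $ i) ^ Poly_Mapping.lookup m i))" if "K \<subseteq> Poly_Mapping.keys f" for K
    using finite_subset[OF that finite_keys] that
    by (induction K rule: finite_induct) (auto intro: mono'[OF const] add monom)
  thus ?thesis
    by (simp add: eval_real_def[abs_def] eval_mpoly_def)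
qed

section \<open>Polynomials under doubling on the lattice\<close>

lemma dyadic_poly_zero: "dyadic_poly n (\<lambda>_. 0)"
  by (induction n) (auto intro: exI[of _ 0])

lemma dyadic_polyI:
  assumes "\<And>k. norm (g k) \<le> C * wt k powr real n"
    and "\<And>A. dyadic_poly n (\<lambda>k. g (dbl A k) - 2 ^ n * g k)"
  shows "dyadic_poly (Suc n) g"
  using assms by auto

lemma has_order_const_bound:
  assumes "has_order e (\<lambda>_. a)"
  obtains C where "\<And>k. norm (a k) \<le> C * wt k powr e"
proof -
  obtain C where C: "\<And>s k. norm (s :: complex) \<le> 0 \<Longrightarrow> norm (a k) \<le> C * wt k powr e"
    using has_orderE[OF assms] by metis
  show ?thesis
    by (rule that[OF C[of 0]]) simp
qed

lemma dyadic_poly_add: "dyadic_poly n a \<Longrightarrow> dyadic_poly n b \<Longrightarrow> dyadic_poly n (\<lambda>k. a k + b k)"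
proof (induction n arbitrary: a b)
  case (Suc n)
  obtain C D where "\<And>k. norm (a k) \<le> C * wt k powr real n" "\<And>k. norm (b k) \<le> D * wt k powr real n"
    using Suc.prems by auto
  hence "norm (a k + b k) \<le> (C + D) * wt k powr real n" for k
    by (metis (no_types) distrib_right norm_triangle_mono)
  moreover have "dyadic_poly n (\<lambda>k. (a (dbl A k) - 2 ^ n * a k) + (b (dbl A k) - 2 ^ n * b k))" for A
    using Suc.prems by (intro Suc.IH) auto
  ultimately show ?case
    by (intro dyadic_polyI[of _ "C + D"]) (simp_all add: algebra_simps)
qed simp

lemma dyadic_poly_cmult: "dyadic_poly n a \<Longrightarrow> dyadic_poly n (\<lambda>k. c * a k)"
proof (induction n arbitrary: a)
  case (Suc n)
  obtain C where "\<And>k. norm (a k) \<le> C * wt k powr real n"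
    using Suc.prems by auto
  hence "norm (c * a k) \<le> (norm c * C) * wt k powr real n" for k
    by (simp add: norm_mult mult.assoc mult_left_mono)
  moreover have "dyadic_poly n (\<lambda>k. c * (a (dbl A k) - 2 ^ n * a k))" for A
    using Suc.prems by (intro Suc.IH) auto
  ultimately show ?case
    by (intro dyadic_polyI[of _ "norm c * C"]) (simp_all add: algebra_simps)
qed simp

lemma dyadic_poly_Suc: "dyadic_poly n a \<Longrightarrow> dyadic_poly (Suc n) a"
proof (induction n arbitrary: a)
  case 0
  hence "a = (\<lambda>_. 0)" by auto
  thus ?case using dyadic_poly_zero by metis
next
  case (Suc n)
  have "has_order (real n) (\<lambda>_. a)"
    using symbol_has_order[OF dyadic_poly_symbol[OF Suc.prems]] by simp
  hence "has_order (real (Suc n)) (\<lambda>_. a)"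
    by (rule has_order_mono) simp
  then obtain C where "\<And>k. norm (a k) \<le> C * wt k powr real (Suc n)"
    by (rule has_order_const_bound) blast
  moreover have "dyadic_poly (Suc n) (\<lambda>k. a (dbl A k) - 2 ^ Suc n * a k)" for A
  proof -
    have "dyadic_poly (Suc n) (\<lambda>k. (a (dbl A k) - 2 ^ n * a k) + (- (2 ^ n)) * a k)"
      by (intro dyadic_poly_add dyadic_poly_cmult Suc.IH dyadic_poly_Suc_sub Suc.prems)
    thus ?thesis
      by (simp add: algebra_simps del: dyadic_poly.simps)
  qed
  ultimately show ?case
    by (rule dyadic_polyI)
qed

lemma dyadic_poly_dbl:
  assumes "dyadic_poly (Suc n) a"
  shows "dyadic_poly (Suc n) (\<lambda>k. a (dbl A k))"
proof -
  have "dyadic_poly (Suc n) (\<lambda>k. (a (dbl A k) - 2 ^ n * a k) + 2 ^ n * a k)"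
    by (intro dyadic_poly_add dyadic_poly_cmult dyadic_poly_Suc dyadic_poly_Suc_sub assms)
  thus ?thesis by simp
qed

text \<open>The Leibniz rule again, by induction on the total degree. A factor of degree 0 is
  treated apart: its doubling difference is zero, and there is no lower degree to recurse
  to.\<close>

lemma dyadic_poly_mult:
  "dyadic_poly (Suc n) a \<Longrightarrow> dyadic_poly (Suc m) b \<Longrightarrow> dyadic_poly (Suc (n + m)) (\<lambda>k. a k * b k)"
proof (induction "n + m" arbitrary: n m a b rule: less_induct)
  case less
  note a = less.prems(1) and b = less.prems(2)
  have "has_order (real n + real m) (\<lambda>_ k. a k * b k)"
    using symbol_has_order[OF dyadic_poly_symbol[OF a]] symbol_has_order[OF dyadic_poly_symbol[OF b]]
    by (intro has_order_mult) auto
  then obtain C where C: "\<And>k. norm (a k * b k) \<le> C * wt k powr (real n + real m)"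
    by (rule has_order_const_bound) blast
  have "dyadic_poly (n + m) (\<lambda>k. (a (dbl A k) - 2 ^ n * a k) * b (dbl A k))" for A
  proof (cases n)
    case 0
    have "a (dbl A k) - 2 ^ n * a k = 0" for k
      using dyadic_poly_Suc_sub[OF a, of A] 0 by simp
    thus ?thesis by (simp add: dyadic_poly_zero)
  next
    case (Suc n')
    have "dyadic_poly (Suc n') (\<lambda>k. a (dbl A k) - 2 ^ n * a k)"
      using dyadic_poly_Suc_sub[OF a] Suc by (simp only:)
    thus ?thesis
      using less.hyps[OF _ _ dyadic_poly_dbl[OF b], of n' _ A] Suc by (simp del: dyadic_poly.simps)
  qed
  moreover have "dyadic_poly (n + m) (\<lambda>k. a k * (b (dbl A k) - 2 ^ m * b k))" for A
  proof (cases m)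
    case 0
    have "b (dbl A k) - 2 ^ m * b k = 0" for k
      using dyadic_poly_Suc_sub[OF b, of A] 0 by simp
    thus ?thesis by (simp add: dyadic_poly_zero)
  next
    case (Suc m')
    have "dyadic_poly (Suc m') (\<lambda>k. b (dbl A k) - 2 ^ m * b k)"
      using dyadic_poly_Suc_sub[OF b] Suc by (simp only:)
    thus ?thesis
      using less.hyps[OF _ a, of m'] Suc by (simp del: dyadic_poly.simps)
  qed
  ultimately have "dyadic_poly (n + m) (\<lambda>k. (a (dbl A k) - 2 ^ n * a k) * b (dbl A k) +
      2 ^ n * (a k * (b (dbl A k) - 2 ^ m * b k)))" for A
    by (intro dyadic_poly_add dyadic_poly_cmult)
  thus ?case
    using C by (intro dyadic_polyI[of _ C \<open>n + m\<close>]) (simp_all add: algebra_simps power_add)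
qed

lemma le_wt: "real (k i) \<le> wt k"
  using member_le_sum[of i UNIV "\<lambda>i. real (k i)"] by (simp add: wt_def)

lemma dyadic_poly_eval: "dyadic_poly (Suc (total_degree f)) (\<lambda>k. eval_real f (lattice_point k))"
proof (rule eval_real_closure[where P = "\<lambda>d h. dyadic_poly (Suc d) (\<lambda>k. h (lattice_point k))"])
  have one: "dyadic_poly (Suc 0) (\<lambda>_ :: 'a \<Rightarrow> nat. c)" for c
  proof (rule dyadic_polyI)
    show "norm c \<le> norm c * wt k powr real 0" for k :: "'a \<Rightarrow> nat"
      using wt_pos[of k] by simp
  qed simp
  show "dyadic_poly (Suc 0) (\<lambda>_ :: 'a \<Rightarrow> nat. c)" for c by (rule one)
  show "dyadic_poly (Suc 1) (\<lambda>k :: 'a \<Rightarrow> nat. of_real (lattice_point k $ i))" for i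
  proof -
    have "norm (of_real (lattice_point k $ i) :: complex) \<le> 1 * wt k powr real 1" for k :: "'a \<Rightarrow> nat"
      using le_wt[of k i] wt_pos[of k] by (simp add: lattice_point_def)
    moreover have "dyadic_poly 1 (\<lambda>k :: 'a \<Rightarrow> nat. of_real (lattice_point (dbl A k) $ i)
        - 2 ^ 1 * of_real (lattice_point k $ i))" for A
    proof -
      have "(\<lambda>k :: 'a \<Rightarrow> nat. of_real (lattice_point (dbl A k) $ i) - 2 ^ 1 * of_real (lattice_point k $ i)) =
          (\<lambda>_. of_bool (i \<in> A) :: complex)"
        by (simp add: lattice_point_def dbl_def fun_eq_iff)
      thus ?thesis
        using one[of "of_bool (i \<in> A)"] by (simp only: One_nat_def)
    qed
    ultimately show ?thesis
      by (rule dyadic_polyI)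
  qed
qed (auto intro: dyadic_poly_add dyadic_poly_Suc dyadic_poly_mult simp del: dyadic_poly.simps)

section \<open>Polynomials along dilations of the orthant\<close>

definition orthant_wt :: "real ^ 'p::finite \<Rightarrow> real"
  where "orthant_wt x = 1 + (\<Sum>i\<in>UNIV. x $ i)"

text \<open>The path \<open>t \<mapsto> dilate t A x\<close>, \<open>0 \<le> t \<le> 1\<close>, joins the lattice point \<open>k\<close> to \<open>dbl A k\<close>.
  Comparing \<open>f\<close> with \<open>(1 + t)\<^sup>d f(x)\<close> along it pins down the branch of the logarithm.\<close>

definition dilate :: "real \<Rightarrow> 'p set \<Rightarrow> real ^ 'p::finite \<Rightarrow> real ^ 'p"
  where "dilate t A x = (\<chi> i. (1 + t) * x $ i + t * of_bool (i \<in> A))"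

text \<open>The remainder has degree \<open>d - 1\<close>; multiplying it by
  \<open>orthant_wt x\<close> avoids that exponent, which would be truncated at
  \<open>d = 0\<close>. The constant is uniform in \<open>t\<close>, so the whole path is controlled
  and not only its endpoint.\<close>

definition dilation_regular :: "nat \<Rightarrow> (real ^ 'p::finite \<Rightarrow> complex) \<Rightarrow> bool"
  where "dilation_regular d h \<longleftrightarrow> (\<exists>C. \<forall>x\<in>nonneg_orthant. norm (h x) \<le> C * orthant_wt x ^ d \<and>
    (\<forall>A. \<forall>t\<in>{0..1}. norm (h (dilate t A x) - of_real ((1 + t) ^ d) * h x) * orthant_wt x \<le> C * orthant_wt x ^ d))"

lemma dilation_regularE:
  assumes "dilation_regular d h"
  obtains C where "C \<ge> 0" "\<And>x. x \<in> nonneg_orthant \<Longrightarrow> norm (h x) \<le> C * orthant_wt x ^ d"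
    "\<And>x A t. x \<in> nonneg_orthant \<Longrightarrow> t \<in> {0..1} \<Longrightarrow>
       norm (h (dilate t A x) - of_real ((1 + t) ^ d) * h x) * orthant_wt x \<le> C * orthant_wt x ^ d"
proof -
  obtain C where C: "\<And>x. x \<in> nonneg_orthant \<Longrightarrow> norm (h x) \<le> C * orthant_wt x ^ d"
    "\<And>x A t. x \<in> nonneg_orthant \<Longrightarrow> t \<in> {0..1} \<Longrightarrow>
       norm (h (dilate t A x) - of_real ((1 + t) ^ d) * h x) * orthant_wt x \<le> C * orthant_wt x ^ d"
    using assms unfolding dilation_regular_def by blast
  have "(0 :: real ^ 'a) \<in> nonneg_orthant"
    by (simp add: nonneg_orthant_def)
  from C(1)[OF this] have "norm (h 0) \<le> C"
    by (simp add: orthant_wt_def)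
  hence "C \<ge> 0"
    using norm_ge_zero[of "h 0"] by linarith
  thus ?thesis using that C by blast
qed

lemma dilation_regularI:
  assumes "\<And>x. x \<in> nonneg_orthant \<Longrightarrow> norm (h x) \<le> B * orthant_wt x ^ d"
    and "\<And>x A t. x \<in> nonneg_orthant \<Longrightarrow> t \<in> {0..1} \<Longrightarrow>
       norm (h (dilate t A x) - of_real ((1 + t) ^ d) * h x) * orthant_wt x \<le> C * orthant_wt x ^ d"
  shows "dilation_regular d h"
  unfolding dilation_regular_def
proof (intro exI[of _ "max B C"] ballI conjI allI)
  fix x :: "real ^ 'a"
  assume x: "x \<in> nonneg_orthant"
  hence "orthant_wt x \<ge> 0"
    by (auto simp: orthant_wt_def nonneg_orthant_def intro!: add_nonneg_nonneg sum_nonneg)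
  hence *: "B * orthant_wt x ^ d \<le> max B C * orthant_wt x ^ d" "C * orthant_wt x ^ d \<le> max B C * orthant_wt x ^ d"
    by (auto intro!: mult_right_mono)
  show "norm (h x) \<le> max B C * orthant_wt x ^ d"
    using assms(1)[OF x] * by linarith
  fix A t assume t: "t \<in> {0..1::real}"
  show "norm (h (dilate t A x) - of_real ((1 + t) ^ d) * h x) * orthant_wt x \<le> max B C * orthant_wt x ^ d"
    using assms(2)[OF x t, of A] * by linarith
qed

lemma orthant_wt_ge_1: "x \<in> nonneg_orthant \<Longrightarrow> orthant_wt x \<ge> 1"
  by (simp add: orthant_wt_def nonneg_orthant_def sum_nonneg)

lemma dilate_orthant: "x \<in> nonneg_orthant \<Longrightarrow> t \<in> {0..1} \<Longrightarrow> dilate t A x \<in> nonneg_orthant"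
  by (simp add: nonneg_orthant_def dilate_def)

lemma orthant_wt_dilate:
  fixes x :: "real ^ 'p::finite"
  assumes "x \<in> nonneg_orthant" "t \<in> {0..1}"
  shows "orthant_wt (dilate t A x) \<le> (2 + CARD('p)) * orthant_wt x"
proof -
  have "orthant_wt (dilate t A x) = 1 + (1 + t) * (\<Sum>i\<in>UNIV. x $ i) + t * (\<Sum>i\<in>UNIV. of_bool (i \<in> A))"
    by (simp add: orthant_wt_def dilate_def sum.distrib sum_distrib_left)
  also have "(\<Sum>i\<in>UNIV. of_bool (i \<in> A) :: real) \<le> (\<Sum>i\<in>(UNIV :: 'p set). 1)"
    by (intro sum_mono) auto
  hence "t * (\<Sum>i\<in>UNIV. of_bool (i \<in> A)) \<le> 1 * real CARD('p)"
    using assms(2) by (intro mult_mono) (auto intro: sum_nonneg)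
  also have "(1 + t) * (\<Sum>i\<in>UNIV. x $ i) \<le> 2 * (\<Sum>i\<in>UNIV. x $ i)"
    using assms by (intro mult_right_mono) (auto simp: nonneg_orthant_def sum_nonneg)
  also have "1 + 2 * (\<Sum>i\<in>UNIV. x $ i) + 1 * real CARD('p) \<le> 2 * orthant_wt x + CARD('p) * 1"
    by (simp add: orthant_wt_def)
  also have "\<dots> \<le> 2 * orthant_wt x + CARD('p) * orthant_wt x"
    using orthant_wt_ge_1[OF assms(1)] by (intro add_left_mono mult_left_mono) auto
  finally show ?thesis by (simp add: algebra_simps)
qed

lemma norm_dilate_le:
  fixes h :: "real ^ 'p::finite \<Rightarrow> complex"
  assumes "\<And>x. x \<in> nonneg_orthant \<Longrightarrow> norm (h x) \<le> C * orthant_wt x ^ d" "C \<ge> 0"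
    and "x \<in> nonneg_orthant" "t \<in> {0..1}"
  shows "norm (h (dilate t A x)) \<le> C * (2 + CARD('p)) ^ d * orthant_wt x ^ d"
proof -
  have "norm (h (dilate t A x)) \<le> C * orthant_wt (dilate t A x) ^ d"
    by (intro assms dilate_orthant)
  also have "\<dots> \<le> C * ((2 + CARD('p)) * orthant_wt x) ^ d"
    using orthant_wt_dilate[OF assms(3,4), of A] orthant_wt_ge_1[OF dilate_orthant[OF assms(3,4)], of A] assms(2)
    by (intro mult_left_mono power_mono) auto
  finally show ?thesis by (simp add: power_mult_distrib mult.assoc)
qed

lemma dilation_regular_eval:
  fixes f :: "('p::finite, complex) mpoly"
  assumes "total_degree f \<le> d"
  shows "dilation_regular d (eval_real f)"
proof (rule eval_real_closure[OF _ _ _ _ _ assms])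
  show "dilation_regular 0 (\<lambda>_ :: real ^ 'p. c)" for c
    by (rule dilation_regularI[of _ "norm c" _ 0]) auto
next
  show "dilation_regular 1 (\<lambda>x :: real ^ 'p. of_real (x $ i))" for i
  proof (rule dilation_regularI[of _ 1 _ 1])
    fix x :: "real ^ 'p" assume x: "x \<in> nonneg_orthant"
    show "norm (of_real (x $ i) :: complex) \<le> 1 * orthant_wt x ^ 1"
      using x member_le_sum[of i UNIV "\<lambda>i. x $ i"] by (simp add: nonneg_orthant_def orthant_wt_def)
    fix A and t :: real assume t: "t \<in> {0..1}"
    have "complex_of_real (dilate t A x $ i) - of_real ((1 + t) ^ 1) * of_real (x $ i) = of_real (t * of_bool (i \<in> A))"
      by (simp add: dilate_def algebra_simps)
    moreover have "norm (complex_of_real (t * of_bool (i \<in> A))) \<le> 1"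
      using t by simp
    ultimately show "norm (complex_of_real (dilate t A x $ i) - of_real ((1 + t) ^ 1) * of_real (x $ i)) * orthant_wt x
        \<le> 1 * orthant_wt x ^ 1"
      using orthant_wt_ge_1[OF x] by (simp only: power_one_right) (intro mult_right_mono, auto)
  qed
next
  fix d and a b :: "real ^ 'p \<Rightarrow> complex"
  assume "dilation_regular d a" "dilation_regular d b"
  obtain B where B: "B \<ge> 0" "\<And>x. x \<in> nonneg_orthant \<Longrightarrow> norm (a x) \<le> B * orthant_wt x ^ d"
    "\<And>x A t. x \<in> nonneg_orthant \<Longrightarrow> t \<in> {0..1} \<Longrightarrow>
       norm (a (dilate t A x) - of_real ((1 + t) ^ d) * a x) * orthant_wt x \<le> B * orthant_wt x ^ d"
    using dilation_regularE[OF \<open>dilation_regular d a\<close>] by metis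
  obtain C where C: "C \<ge> 0" "\<And>x. x \<in> nonneg_orthant \<Longrightarrow> norm (b x) \<le> C * orthant_wt x ^ d"
    "\<And>x A t. x \<in> nonneg_orthant \<Longrightarrow> t \<in> {0..1} \<Longrightarrow>
       norm (b (dilate t A x) - of_real ((1 + t) ^ d) * b x) * orthant_wt x \<le> C * orthant_wt x ^ d"
    using dilation_regularE[OF \<open>dilation_regular d b\<close>] by metis
  show "dilation_regular d (\<lambda>x. a x + b x)"
  proof (rule dilation_regularI[of _ "B + C" _ "B + C"])
    fix x :: "real ^ 'p" assume x: "x \<in> nonneg_orthant"
    show "norm (a x + b x) \<le> (B + C) * orthant_wt x ^ d"
      using norm_triangle_ineq[of "a x" "b x"] B(2)[OF x] C(2)[OF x] by (simp add: algebra_simps)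
    fix A and t :: real assume t: "t \<in> {0..1}"
    have "a (dilate t A x) + b (dilate t A x) - of_real ((1 + t) ^ d) * (a x + b x) =
      (a (dilate t A x) - of_real ((1 + t) ^ d) * a x) + (b (dilate t A x) - of_real ((1 + t) ^ d) * b x)"
      by (simp add: algebra_simps)
    hence "norm (a (dilate t A x) + b (dilate t A x) - of_real ((1 + t) ^ d) * (a x + b x)) * orthant_wt x \<le>
      (norm (a (dilate t A x) - of_real ((1 + t) ^ d) * a x) + norm (b (dilate t A x) - of_real ((1 + t) ^ d) * b x)) * orthant_wt x"
      using orthant_wt_ge_1[OF x] by (intro mult_right_mono) (auto simp only: norm_triangle_ineq)
    also have "\<dots> \<le> (B + C) * orthant_wt x ^ d"
      using B(3)[OF x t, of A] C(3)[OF x t, of A] by (simp only: distrib_right add_mono)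
    finally show "norm (a (dilate t A x) + b (dilate t A x) - of_real ((1 + t) ^ d) * (a x + b x)) * orthant_wt x
      \<le> (B + C) * orthant_wt x ^ d" .
  qed
next
  fix d e and a b :: "real ^ 'p \<Rightarrow> complex"
  assume "dilation_regular d a" "dilation_regular e b"
  obtain B where B: "B \<ge> 0" "\<And>x. x \<in> nonneg_orthant \<Longrightarrow> norm (a x) \<le> B * orthant_wt x ^ d"
    "\<And>x A t. x \<in> nonneg_orthant \<Longrightarrow> t \<in> {0..1} \<Longrightarrow>
       norm (a (dilate t A x) - of_real ((1 + t) ^ d) * a x) * orthant_wt x \<le> B * orthant_wt x ^ d"
    using dilation_regularE[OF \<open>dilation_regular d a\<close>] by metis
  obtain C where C: "C \<ge> 0" "\<And>x. x \<in> nonneg_orthant \<Longrightarrow> norm (b x) \<le> C * orthant_wt x ^ e"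
    "\<And>x A t. x \<in> nonneg_orthant \<Longrightarrow> t \<in> {0..1} \<Longrightarrow>
       norm (b (dilate t A x) - of_real ((1 + t) ^ e) * b x) * orthant_wt x \<le> C * orthant_wt x ^ e"
    using dilation_regularE[OF \<open>dilation_regular e b\<close>] by metis
  \<comment> \<open>In the Leibniz rule \<open>b\<close> is evaluated at the dilated point, whose
    weight may be larger by the factor \<open>2 + p\<close>.\<close>
  define C' where "C' = C * (2 + CARD('p)) ^ e"
  show "dilation_regular (d + e) (\<lambda>x. a x * b x)"
  proof (rule dilation_regularI[of _ "B * C" _ "B * C' + 2 ^ d * B * C"])
    fix x :: "real ^ 'p" assume x: "x \<in> nonneg_orthant"
    have w: "orthant_wt x \<ge> 1" by (rule orthant_wt_ge_1[OF x])
    have "norm (a x) * norm (b x) \<le> (B * orthant_wt x ^ d) * (C * orthant_wt x ^ e)"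
      using w B(1) by (intro mult_mono B C x) auto
    thus "norm (a x * b x) \<le> (B * C) * orthant_wt x ^ (d + e)"
      by (simp add: norm_mult power_add algebra_simps)
    fix A and t :: real assume t: "t \<in> {0..1}"
    define \<delta>a where "\<delta>a = a (dilate t A x) - of_real ((1 + t) ^ d) * a x"
    define \<delta>b where "\<delta>b = b (dilate t A x) - of_real ((1 + t) ^ e) * b x"
    have \<delta>a: "norm \<delta>a * orthant_wt x \<le> B * orthant_wt x ^ d"
      unfolding \<delta>a_def by (rule B(3)[OF x t])
    have \<delta>b: "norm \<delta>b * orthant_wt x \<le> C * orthant_wt x ^ e"
      unfolding \<delta>b_def by (rule C(3)[OF x t])
    have b_le: "norm (b (dilate t A x)) \<le> C' * orthant_wt x ^ e"
      unfolding C'_def by (rule norm_dilate_le[OF C(2,1) x t])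
    have t2: "norm (of_real ((1 + t) ^ d) :: complex) \<le> 2 ^ d"
      using t by (simp only: norm_of_real) (auto simp: power_abs intro!: power_mono)
    have "a (dilate t A x) * b (dilate t A x) - of_real ((1 + t) ^ (d + e)) * (a x * b x) =
        \<delta>a * b (dilate t A x) + of_real ((1 + t) ^ d) * a x * \<delta>b"
      by (simp add: \<delta>a_def \<delta>b_def power_add algebra_simps)
    hence "norm (a (dilate t A x) * b (dilate t A x) - of_real ((1 + t) ^ (d + e)) * (a x * b x)) * orthant_wt x
        \<le> (norm (\<delta>a * b (dilate t A x)) + norm (of_real ((1 + t) ^ d) * a x * \<delta>b)) * orthant_wt x"
      using w by (intro mult_right_mono) (auto simp only: norm_triangle_ineq)
    also have "\<dots> = (norm \<delta>a * orthant_wt x) * norm (b (dilate t A x)) +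
        norm (of_real ((1 + t) ^ d) :: complex) * norm (a x) * (norm \<delta>b * orthant_wt x)"
      by (simp only: norm_mult) (simp only: algebra_simps)
    also have "\<dots> \<le> (B * orthant_wt x ^ d) * (C' * orthant_wt x ^ e) +
        2 ^ d * (B * orthant_wt x ^ d) * (C * orthant_wt x ^ e)"
      using w B(1) C(1) by (intro add_mono mult_mono \<delta>a \<delta>b b_le t2 B(2) x) auto
    also have "\<dots> = (B * C' + 2 ^ d * B * C) * orthant_wt x ^ (d + e)"
      by (simp add: power_add algebra_simps)
    finally show "norm (a (dilate t A x) * b (dilate t A x) - of_real ((1 + t) ^ (d + e)) * (a x * b x)) * orthant_wt x
        \<le> (B * C' + 2 ^ d * B * C) * orthant_wt x ^ (d + e)" .
  qed
next
  fix d and a :: "real ^ 'p \<Rightarrow> complex"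
  assume "dilation_regular d a"
  obtain B where B: "B \<ge> 0" "\<And>x. x \<in> nonneg_orthant \<Longrightarrow> norm (a x) \<le> B * orthant_wt x ^ d"
    using dilation_regularE[OF \<open>dilation_regular d a\<close>] by metis
  \<comment> \<open>One degree higher, no cancellation is called for: \<open>a\<close> and its
    dilate are each bounded by the power \<open>d\<close> of the weight, so the triangle inequality
    suffices.\<close>
  define C where "C = B * (2 + CARD('p)) ^ d + 2 ^ Suc d * B"
  show "dilation_regular (Suc d) a"
  proof (rule dilation_regularI[of _ B _ C])
    fix x :: "real ^ 'p" assume x: "x \<in> nonneg_orthant"
    have w: "orthant_wt x \<ge> 1" by (rule orthant_wt_ge_1[OF x])
    have "B * orthant_wt x ^ d \<le> B * orthant_wt x ^ Suc d"
      using w B(1) by (intro mult_left_mono power_increasing) auto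
    thus "norm (a x) \<le> B * orthant_wt x ^ Suc d"
      using B(2)[OF x] by linarith
    fix A and t :: real assume t: "t \<in> {0..1}"
    have t2: "norm (of_real ((1 + t) ^ Suc d) :: complex) \<le> 2 ^ Suc d"
      using t by (simp only: norm_of_real) (auto simp: power_abs simp del: power_Suc intro!: power_mono)
    have "norm (a (dilate t A x) - of_real ((1 + t) ^ Suc d) * a x) \<le>
        norm (a (dilate t A x)) + norm (of_real ((1 + t) ^ Suc d) :: complex) * norm (a x)"
      by (metis norm_mult norm_triangle_ineq4)
    also have "\<dots> \<le> B * (2 + CARD('p)) ^ d * orthant_wt x ^ d + 2 ^ Suc d * (B * orthant_wt x ^ d)"
      by (intro add_mono norm_dilate_le[OF B(2,1) x t] mult_mono t2 B(2) x) auto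
    also have "\<dots> = C * orthant_wt x ^ d"
      by (simp add: C_def algebra_simps)
    finally have "norm (a (dilate t A x) - of_real ((1 + t) ^ Suc d) * a x) * orthant_wt x \<le> C * orthant_wt x ^ d * orthant_wt x"
      using w by (intro mult_right_mono) auto
    thus "norm (a (dilate t A x) - of_real ((1 + t) ^ Suc d) * a x) * orthant_wt x \<le> C * orthant_wt x ^ Suc d"
      by (simp add: mult.assoc mult.commute[of "orthant_wt x"])
  qed
qed

section \<open>Polynomials satisfying Mahler's hypothesis\<close>

lemma lookup_homogeneous_part:
  "Poly_Mapping.lookup (homogeneous_part d f) m = (if monom_degree m = d then Poly_Mapping.lookup f m else 0)"
  by (auto simp: homogeneous_part_def lookup_sum lookup_single when_def in_keys_iff)

lemma eval_top_part_scaleR: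
  "eval_real (top_part f) (r *\<^sub>R x) = of_real r ^ total_degree f * eval_real (top_part f) x"
proof -
  have "monom_degree m = total_degree f" if "m \<in> Poly_Mapping.keys (top_part f)" for m
    using that by (auto simp: top_part_def in_keys_iff lookup_homogeneous_part split: if_splits)
  hence "(\<Prod>i\<in>UNIV. of_real r ^ Poly_Mapping.lookup m i) = (of_real r ^ total_degree f :: complex)"
    if "m \<in> Poly_Mapping.keys (top_part f)" for m
    using that by (simp add: monom_degree_def flip: power_sum)
  thus ?thesis
    unfolding eval_real_def eval_mpoly_def sum_distrib_left
    by (intro sum.cong) (auto simp: power_mult_distrib prod.distrib mult_ac)
qed

lemma total_degree_diff_top_part:
  fixes f :: "('p::finite, complex) mpoly"
  shows "total_degree (f - top_part f) \<le> total_degree f - 1"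
proof (rule total_degree_le)
  fix m assume "m \<in> Poly_Mapping.keys (f - top_part f)"
  hence "monom_degree m \<noteq> total_degree f" "m \<in> Poly_Mapping.keys f"
    by (auto simp: in_keys_iff lookup_minus top_part_def lookup_homogeneous_part split: if_splits)
  thus "monom_degree m \<le> total_degree f - 1"
    using monom_degree_le[of m f] by linarith
qed

lemma continuous_on_eval_real: "continuous_on S (eval_real f)"
  unfolding eval_real_def[abs_def] eval_mpoly_def by (intro continuous_intros)

lemma orthant_wt_lattice_point: "orthant_wt (lattice_point k) = wt k"
  by (simp add: orthant_wt_def wt_def lattice_point_def)

lemma lattice_point_orthant: "lattice_point k \<in> nonneg_orthant"
  by (simp add: lattice_point_def nonneg_orthant_def)

lemma dilate_lattice_point: "dilate 1 A (lattice_point k) = lattice_point (dbl A k)"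
  by (simp add: dilate_def lattice_point_def dbl_def vec_eq_iff)

lemma Mahler_total_degree_pos:
  assumes "Mahler_hypothesis f"
  shows "total_degree f > 0"
proof (rule ccontr)
  assume "\<not> total_degree f > 0"
  hence "monom_degree m = 0" if "m \<in> Poly_Mapping.keys f" for m
    using monom_degree_le[OF that] by simp
  hence "m = 0" if "m \<in> Poly_Mapping.keys f" for m
    using that by (intro poly_mapping_eqI) (auto simp: monom_degree_def)
  hence "f = Poly_Mapping.single 0 (Poly_Mapping.lookup f 0)"
    by (intro poly_mapping_eqI) (auto simp: lookup_single when_def in_keys_iff)
  thus False
    using assms unfolding Mahler_hypothesis_def constant_mpoly_def by metis
qed

text \<open>By homogeneity it is enough to look at the simplex of coordinate sum 1, which is compact
  and omits 0. The coordinate sum is preferred to the Euclidean norm because at lattice points it is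
  \<open>wt k - 1\<close>.\<close>

lemma Mahler_top_part_lower:
  fixes f :: "('p::finite, complex) mpoly"
  assumes "Mahler_hypothesis f"
  obtains c where "c > 0"
    "\<And>x. x \<in> nonneg_orthant \<Longrightarrow> norm (eval_real (top_part f) x) \<ge> c * (\<Sum>i\<in>UNIV. x $ i) ^ total_degree f"
proof -
  define K where "K = {x :: real ^ 'p. x \<in> nonneg_orthant \<and> (\<Sum>i\<in>UNIV. x $ i) = 1}"
  have "closed K"
    unfolding K_def nonneg_orthant_def Collect_conj_eq mem_Collect_eq
    by (intro closed_Int closed_Collect_all closed_Collect_le closed_Collect_eq continuous_intros)
  moreover have "norm x \<le> 1" if "x \<in> K" for x
    using norm_le_l1_cart[of x] that by (simp add: K_def nonneg_orthant_def)
  hence "bounded K"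
    using bounded_iff by blast
  ultimately have "compact K"
    by (simp add: compact_eq_bounded_closed)
  \<comment> \<open>Any vertex of the simplex shows that it is nonempty.\<close>
  moreover have "axis undefined 1 \<in> K"
    by (auto simp: K_def nonneg_orthant_def axis_def)
  hence "K \<noteq> {}" by blast
  ultimately obtain z where z: "z \<in> K"
      "\<And>x. x \<in> K \<Longrightarrow> norm (eval_real (top_part f) z) \<le> norm (eval_real (top_part f) x)"
    using continuous_attains_inf[OF _ _ continuous_on_norm[OF continuous_on_eval_real], of K "top_part f"]
    by blast
  define c where "c = norm (eval_real (top_part f) z)"
  have "z \<noteq> 0" "z \<in> nonneg_orthant"
    using z(1) by (auto simp: K_def)
  hence "c > 0"
    using assms by (auto simp: c_def Mahler_hypothesis_def)
  moreover have "c * (\<Sum>i\<in>UNIV. x $ i) ^ total_degree f \<le> norm (eval_real (top_part f) x)"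
    if x: "x \<in> nonneg_orthant" for x
  proof (cases "(\<Sum>i\<in>UNIV. x $ i) = 0")
    case True
    thus ?thesis
      using Mahler_total_degree_pos[OF assms] by (simp add: zero_power)
  next
    case False
    define r where "r = (\<Sum>i\<in>UNIV. x $ i)"
    have "r > 0"
      using False x by (simp add: r_def nonneg_orthant_def order.not_eq_order_implies_strict sum_nonneg)
    have "x /\<^sub>R r \<in> K"
      using x \<open>r > 0\<close> by (auto simp: K_def nonneg_orthant_def r_def simp flip: sum_divide_distrib divide_inverse sum_distrib_left)
    hence "c \<le> norm (eval_real (top_part f) (x /\<^sub>R r))"
      unfolding c_def by (rule z(2))
    hence "c * r ^ total_degree f \<le> r ^ total_degree f * norm (eval_real (top_part f) (x /\<^sub>R r))"
      using \<open>r > 0\<close> by (simp add: mult.commute mult_left_mono)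
    also have "\<dots> = norm (eval_real (top_part f) (r *\<^sub>R (x /\<^sub>R r)))"
      unfolding eval_top_part_scaleR[of f r] using \<open>r > 0\<close> by (simp add: norm_mult norm_power)
    finally show ?thesis
      using \<open>r > 0\<close> by (simp add: r_def)
  qed
  ultimately show ?thesis using that by blast
qed

text \<open>The top part dominates once the weight is large. Only finitely many lattice points are
  left, and \<open>f\<close> vanishes at none of them, so a minimum over them is positive.\<close>

lemma Mahler_lower_bound:
  fixes f :: "('p::finite, complex) mpoly"
  assumes "Mahler_hypothesis f"
  obtains c where "c > 0" "\<And>k. norm (eval_real f (lattice_point k)) \<ge> c * wt k ^ total_degree f"
proof -
  define d where "d = total_degree f"
  have "d > 0"
    unfolding d_def by (rule Mahler_total_degree_pos[OF assms])
  obtain c where c: "c > 0" "\<And>x. x \<in> nonneg_orthant \<Longrightarrow>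
      norm (eval_real (top_part f) x) \<ge> c * (\<Sum>i\<in>UNIV. x $ i) ^ d"
    using Mahler_top_part_lower[OF assms] unfolding d_def by metis
  have "dilation_regular (d - 1) (eval_real (f - top_part f))"
    unfolding d_def by (rule dilation_regular_eval[OF total_degree_diff_top_part])
  then obtain B where B: "B \<ge> 0"
      "\<And>x. x \<in> nonneg_orthant \<Longrightarrow> norm (eval_real (f - top_part f) x) \<le> B * orthant_wt x ^ (d - 1)"
    by (rule dilation_regularE) blast
  \<comment> \<open>The power \<open>2 ^ d\<close> reflects \<open>wt k - 1 \<ge> wt k / 2\<close>
    for weights at least 2. Beyond \<open>W\<close> the lower-degree part is at most half of the
    resulting bound.\<close>
  define c' where "c' = c / 2 ^ d"
  define W where "W = max 2 (2 * B / c')"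
  have "c' > 0" using c(1) by (simp add: c'_def)
  have large: "c' / 2 * wt k ^ d \<le> norm (eval_real f (lattice_point k))" if k: "wt k > W" for k
  proof -
    let ?x = "lattice_point k"
    have w: "wt k \<ge> 2" "2 * B / c' \<le> wt k"
      using k by (simp_all add: W_def)
    have "(\<Sum>i\<in>UNIV. ?x $ i) = wt k - 1"
      by (simp add: wt_def lattice_point_def)
    hence "c * (wt k - 1) ^ d \<le> norm (eval_real (top_part f) ?x)"
      using c(2)[OF lattice_point_orthant, of k] by simp
    moreover have "c' * wt k ^ d = c * (wt k / 2) ^ d"
      by (simp add: c'_def power_divide)
    moreover have "c * (wt k / 2) ^ d \<le> c * (wt k - 1) ^ d"
      using w c(1) by (intro mult_left_mono power_mono) auto
    moreover have "norm (eval_real (f - top_part f) ?x) \<le> B * wt k ^ (d - 1)"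
      using B(2)[OF lattice_point_orthant, of k] by (simp add: orthant_wt_lattice_point)
    moreover have "B * wt k ^ (d - 1) \<le> (c' / 2 * wt k) * wt k ^ (d - 1)"
      using w \<open>c' > 0\<close> by (intro mult_right_mono) (auto simp: field_simps)
    moreover have "(c' / 2 * wt k) * wt k ^ (d - 1) = c' / 2 * wt k ^ d"
      using \<open>d > 0\<close> by (simp add: power_eq_if)
    moreover have "eval_real f ?x = eval_real (top_part f) ?x + eval_real (f - top_part f) ?x"
      by (simp add: eval_real_def flip: eval_mpoly_add)
    hence "norm (eval_real (top_part f) ?x) - norm (eval_real (f - top_part f) ?x) \<le> norm (eval_real f ?x)"
      by (metis norm_diff_ineq)
    ultimately show ?thesis by linarith
  qed
  define q where "q = (\<lambda>k. norm (eval_real f (lattice_point k)) / wt k ^ d)"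
  define F where "F = {k :: 'p \<Rightarrow> nat. wt k \<le> W}"
  have "finite F" unfolding F_def by (rule finite_wt_le)
  have q_pos: "q k > 0" for k
    using assms lattice_point_orthant[of k] wt_pos[of k] by (simp add: q_def Mahler_hypothesis_def)
  define m where "m = Min (insert (c' / 2) (q ` F))"
  have m: "m \<le> c' / 2" "\<And>k. k \<in> F \<Longrightarrow> m \<le> q k"
    using \<open>finite F\<close> unfolding m_def by (intro Min_le; simp)+
  have "m > 0"
    using \<open>finite F\<close> \<open>c' > 0\<close> q_pos by (auto simp: m_def)
  moreover have "m * wt k ^ d \<le> norm (eval_real f (lattice_point k))" for k
  proof (cases "k \<in> F")
    case True
    thus ?thesis
      using m(2)[OF True] wt_pos[of k] by (simp add: q_def field_simps)
  next
    case False
    have "m * wt k ^ d \<le> c' / 2 * wt k ^ d"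
      using m(1) wt_pos[of k] by (intro mult_right_mono) auto
    also have "\<dots> \<le> norm (eval_real f (lattice_point k))"
      using False by (intro large) (simp add: F_def)
    finally show ?thesis .
  qed
  ultimately show ?thesis using that unfolding d_def by blast
qed

section \<open>Branches of the logarithm\<close>

lemma exp_eq_1_imp_eq:
  fixes g :: "'a::topological_space \<Rightarrow> complex"
  assumes "connected S" "continuous_on S g" "\<And>x. x \<in> S \<Longrightarrow> exp (g x) = 1" "a \<in> S" "b \<in> S"
  shows "g a = g b"
proof -
  have "\<exists>e>0. \<forall>y. y \<in> S \<and> g y \<noteq> g x \<longrightarrow> e \<le> norm (g y - g x)" if x: "x \<in> S" for x
  proof (intro exI[of _ "2 * pi"] conjI allI impI)
    fix y assume y: "y \<in> S \<and> g y \<noteq> g x"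
    have "exp (g y - g x) = 1"
      using assms(3) x y by (simp add: exp_diff)
    then obtain n :: int where n: "Re (g y - g x) = 0" "Im (g y - g x) = of_int (2 * n) * pi"
      unfolding exp_eq_1 by blast
    hence "n \<noteq> 0"
      using y by (auto simp: complex_eq_iff)
    hence "1 \<le> \<bar>real_of_int n\<bar>" by linarith
    hence "2 * pi \<le> \<bar>Im (g y - g x)\<bar>"
      unfolding n(2) by (simp add: abs_mult)
    also have "\<dots> \<le> norm (g y - g x)" by (rule abs_Im_le_cmod)
    finally show "2 * pi \<le> norm (g y - g x)" .
  qed auto
  hence "g constant_on S"
    by (rule continuous_discrete_range_constant[OF assms(1,2)])
  thus ?thesis
    using assms(4,5) by (auto simp: constant_on_def)
qed

text \<open>Comparing exponentials leaves a multiple of 2 pi i undetermined. Along the path the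
  difference of the two sides is continuous with exponential 1 and vanishes at \<open>t = 0\<close>,
  hence also at \<open>t = 1\<close>. The closeness assumption keeps the quotient off the cut of
  \<open>Ln\<close>.\<close>

lemma log_branch_dilate:
  fixes f :: "('p::finite, complex) mpoly"
  assumes L: "log_branch f L" and x: "x \<in> nonneg_orthant"
    and close: "\<And>t. t \<in> {0..1} \<Longrightarrow>
      norm (eval_real f (dilate t A x) / (of_real (1 + t) ^ d * eval_real f x) - 1) < 1"
  shows "L (dilate 1 A x) = L x + of_real (d * ln 2) + Ln (eval_real f (dilate 1 A x) / (2 ^ d * eval_real f x))"
proof -
  let ?q = "\<lambda>t. eval_real f (dilate t A x) / (of_real (1 + t) ^ d * eval_real f x)"
  define g where "g = (\<lambda>t. L (dilate t A x) - L x - of_real (d * ln (1 + t)) - Ln (?q t))"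
  have L': "continuous_on nonneg_orthant L" "\<And>x. x \<in> nonneg_orthant \<Longrightarrow> exp (L x) = eval_real f x"
    using L by (auto simp: log_branch_def)
  have f0: "eval_real f y \<noteq> 0" if "y \<in> nonneg_orthant" for y
    using L'(2)[OF that] exp_not_eq_zero by metis
  have dil: "dilate t A x \<in> nonneg_orthant" if "t \<in> {0..1}" for t
    by (rule dilate_orthant[OF x that])
  have t0: "complex_of_real (1 + t) \<noteq> 0" if "t \<in> {0..1}" for t
    using that by (simp only: of_real_eq_0_iff) auto
  have "continuous_on {0..1} (\<lambda>t. dilate t A x)"
    unfolding dilate_def by (intro continuous_intros continuous_on_vec_lambda)
  hence cL: "continuous_on {0..1} (\<lambda>t. L (dilate t A x))"
      and cf: "continuous_on {0..1} (\<lambda>t. eval_real f (dilate t A x))"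
    using continuous_on_compose2[OF L'(1)] continuous_on_compose2[OF continuous_on_eval_real[of UNIV]] dil by blast+
  have re: "?q t \<notin> \<real>\<^sub>\<le>\<^sub>0" if "t \<in> {0..1}" for t
  proof
    assume "?q t \<in> \<real>\<^sub>\<le>\<^sub>0"
    hence "Re (?q t - 1) \<le> -1"
      by (auto simp: complex_nonpos_Reals_iff simp del: of_real_add)
    thus False
      using abs_Re_le_cmod[of "?q t - 1"] close[OF that] by linarith
  qed
  have "continuous_on {0..1} ?q"
    using t0 f0[OF x] by (intro continuous_intros cf) auto
  hence cLn: "continuous_on {0..1} (\<lambda>t. Ln (?q t))"
    using re by (rule continuous_on_Ln')
  have "continuous_on {0..1} g"
    unfolding g_def by (rule continuous_on_diff[OF _ cLn]) (intro continuous_intros cL, auto)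
  moreover have "exp (g t) = 1" if t: "t \<in> {0..1}" for t
  proof -
    have "exp (of_real (d * ln (1 + t))) = complex_of_real (1 + t) ^ d"
      using t by (simp only: exp_of_real exp_of_nat_mult of_real_power[symmetric]) (simp add: exp_ln)
    moreover have "?q t \<noteq> 0"
      using t0[OF t] f0[OF x] f0[OF dil[OF t]] by simp
    ultimately show ?thesis
      using t0[OF t] f0[OF x] f0[OF dil[OF t]] L'(2)[OF x] L'(2)[OF dil[OF t]]
      unfolding g_def exp_diff by simp
  qed
  ultimately have "g 1 = g 0"
    by (intro exp_eq_1_imp_eq[of "{0..1}" g]) auto
  moreover have "dilate 0 A x = x"
    by (simp add: dilate_def vec_eq_iff)
  hence "g 0 = 0"
    using f0[OF x] by (simp add: g_def)
  ultimately show ?thesis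
    by (simp add: g_def algebra_simps)
qed

text \<open>The quotient of \<open>F (dbl A k)\<close> by \<open>2 ^ d * F k\<close> is 1 plus a
  symbol of order -1, namely a doubling difference times a reciprocal. For large weight the
  increment is its principal logarithm.\<close>

lemma log_branch_log_symbol:
  fixes f :: "('p::finite, complex) mpoly"
  assumes f: "Mahler_hypothesis f" and L: "log_branch f L"
  shows "log_symbol (\<lambda>k. L (lattice_point k)) (total_degree f)"
proof
  define d where "d = total_degree f"
  show "real (total_degree f) > 0"
    using Mahler_total_degree_pos[OF f] by simp
  fix A :: "'p set"
  define F where "F = (\<lambda>k. eval_real f (lattice_point k))"
  obtain c where c: "c > 0" "\<And>k. norm (F k) \<ge> c * wt k ^ d"
    using Mahler_lower_bound[OF f] unfolding F_def d_def by metis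
  obtain C where C: "C \<ge> 0" "\<And>x A t. x \<in> nonneg_orthant \<Longrightarrow> t \<in> {0..1} \<Longrightarrow>
      norm (eval_real f (dilate t A x) - of_real ((1 + t) ^ d) * eval_real f x) * orthant_wt x \<le> C * orthant_wt x ^ d"
    using dilation_regularE[OF dilation_regular_eval[OF order_refl, of f]] unfolding d_def by metis
  have F0: "F k \<noteq> 0" for k
    using f lattice_point_orthant by (auto simp: F_def Mahler_hypothesis_def)
  \<comment> \<open>From this weight on \<open>C \<le> c / 2 * wt k\<close>, so the deviation along
    the path is at most half of \<open>norm (F k)\<close>.\<close>
  define W where "W = 2 * C / c"
  have close: "norm (eval_real f (dilate t A (lattice_point k)) / (of_real (1 + t) ^ d * F k) - 1) \<le> 1 / 2"
    if k: "wt k \<ge> W" and t: "t \<in> {0..1}" for k t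
  proof -
    let ?y = "eval_real f (dilate t A (lattice_point k))"
    let ?r = "complex_of_real (1 + t) ^ d"
    have "norm ?r = (1 + t) ^ d"
      using t by (simp only: norm_power norm_of_real) auto
    hence r: "norm ?r \<ge> 1"
      using t by simp
    hence "?r \<noteq> 0" by (metis norm_zero not_one_le_zero)
    have "norm (?y - ?r * F k) * wt k \<le> C * wt k ^ d"
      using C(2)[OF lattice_point_orthant t, of A k] by (simp only: F_def orthant_wt_lattice_point of_real_power)
    also have "\<dots> \<le> (c / 2 * wt k) * wt k ^ d"
      using k c(1) wt_pos[of k] by (intro mult_right_mono) (auto simp: W_def field_simps)
    finally have "norm (?y - ?r * F k) * wt k \<le> (c / 2 * wt k ^ d) * wt k"
      by (simp add: mult_ac)
    hence "norm (?y - ?r * F k) \<le> c / 2 * wt k ^ d"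
      using wt_pos[of k] by simp
    also have "\<dots> \<le> 1 / 2 * norm (F k)"
      using c(2)[of k] by simp
    also have "\<dots> \<le> 1 / 2 * (norm ?r * norm (F k))"
      using mult_right_mono[OF r, of "norm (F k)"] by simp
    finally have "norm (?y - ?r * F k) / norm (?r * F k) \<le> 1 / 2"
      using \<open>?r \<noteq> 0\<close> F0[of k] by (simp only: norm_mult) (simp add: field_simps)
    moreover have "?y / (?r * F k) - 1 = (?y - ?r * F k) / (?r * F k)"
      using \<open>?r \<noteq> 0\<close> F0[of k] by (simp add: diff_divide_distrib)
    ultimately show ?thesis
      by (simp only: norm_divide)
  qed
  define r where "r = (\<lambda>k. F (dbl A k) / (2 ^ d * F k) - 1)"
  \<comment> \<open>The cut-off keeps \<open>u\<close> within radius 1/2 at every lattice point, a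
    compact part of the disc where Ln (1 + z) is holomorphic. It changes \<open>r\<close> at
    finitely many points only.\<close>
  define u where "u = (\<lambda>k. if wt k \<ge> W then r k else 0)"
  have finW: "finite {k :: 'p \<Rightarrow> nat. \<not> wt k \<ge> W}"
    by (rule finite_subset[OF _ finite_wt_le[of W]]) auto
  have F: "symbol (real d) (\<lambda>_. F)"
    using dyadic_poly_symbol[OF dyadic_poly_eval[of f]] by (simp add: F_def d_def)
  have "c * wt k powr real d \<le> norm (F k)" for k
    using c(2)[of k] wt_pos[of k] by (simp add: powr_realpow)
  hence "symbol (- real d) (\<lambda>_ k. inverse (F k))"
    unfolding symbol_def
    using F c(1) by (intro allI symbol_upto_inverse[of _ c]) (auto simp: symbol_def)
  hence "symbol (real d - 1 + (- real d)) (\<lambda>_ k. (F (dbl A k) - of_real (2 powr real d) * F k) * inverse (F k))"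
    by (intro symbol_mult symbol_dbl_diff F)
  hence "symbol (- 1) (\<lambda>_ k. inverse (2 ^ d) * ((F (dbl A k) - of_real (2 powr real d) * F k) * inverse (F k)))"
    by (intro symbol_cmult) simp
  moreover have "inverse (2 ^ d) * ((F (dbl A k) - of_real (2 powr real d) * F k) * inverse (F k)) = r k" for k
    using F0[of k] by (simp add: r_def powr_realpow field_simps)
  ultimately have "symbol (- 1) (\<lambda>_. r)" by simp
  moreover have "symbol (- 1) (\<lambda>_ k. u k - r k)"
    unfolding symbol_def
    by (intro allI symbol_upto_finite_support finite_subset[OF _ finW]) (auto simp: u_def)
  ultimately have "symbol (- 1) (\<lambda>_ k. r k + (u k - r k))"
    by (rule symbol_add)
  hence u: "symbol (- 1) (\<lambda>_. u)" by simp
  have r_dilate: "r k = eval_real f (dilate 1 A (lattice_point k)) / (of_real (1 + 1) ^ d * F k) - 1" for k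
    by (simp add: r_def F_def dilate_lattice_point)
  have u_small: "u k \<in> cball 0 (1 / 2)" for k
    using close[of k 1] by (simp add: u_def r_dilate)
  have Ln_u: "symbol (- 1) (\<lambda>_ k. Ln (1 + u k))"
  proof (rule symbol_compose_vanishing[OF _ _ u, of "ball 0 1" "\<lambda>z. Ln (1 + z)"])
    have "1 + z \<notin> \<real>\<^sub>\<le>\<^sub>0" if "z \<in> ball 0 1" for z :: complex
    proof
      assume "1 + z \<in> \<real>\<^sub>\<le>\<^sub>0"
      hence "Re z \<le> -1" by (auto simp: complex_nonpos_Reals_iff)
      thus False using abs_Re_le_cmod[of z] that by simp
    qed
    thus "(\<lambda>z. Ln (1 + z)) holomorphic_on ball 0 1"
      by (intro holomorphic_intros)
    fix R :: real
    show "\<exists>K. compact K \<and> K \<subseteq> ball 0 1 \<and> (\<forall>s k. norm (s :: complex) \<le> R \<longrightarrow> u k \<in> K)"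
      using u_small by (intro exI[of _ "cball 0 (1 / 2)"]) auto
  qed auto
  define l where "l = log_increment (\<lambda>k. L (lattice_point k)) (real d) A"
  have "l k = Ln (1 + u k)" if k: "wt k \<ge> W" for k
  proof -
    have "L (dilate 1 A (lattice_point k)) = L (lattice_point k) + of_real (d * ln 2) +
        Ln (eval_real f (dilate 1 A (lattice_point k)) / (2 ^ d * eval_real f (lattice_point k)))"
    proof (rule log_branch_dilate[OF L lattice_point_orthant])
      fix t :: real
      assume "t \<in> {0..1}"
      from close[OF k this] show "norm (eval_real f (dilate t A (lattice_point k)) /
          (of_real (1 + t) ^ d * eval_real f (lattice_point k)) - 1) < 1"
        unfolding F_def by (rule order.strict_trans1) simp
    qed
    thus ?thesis
      using k by (simp add: l_def log_increment_def u_def r_def F_def dilate_lattice_point)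
  qed
  hence "symbol (- 1) (\<lambda>_ k. l k - Ln (1 + u k))"
    unfolding symbol_def
    by (intro allI symbol_upto_finite_support finite_subset[OF _ finW]) auto
  hence "symbol (- 1) (\<lambda>_ k. Ln (1 + u k) + (l k - Ln (1 + u k)))"
    by (rule symbol_add[OF Ln_u])
  thus "symbol (- 1) (\<lambda>_. log_increment (\<lambda>k. L (lattice_point k)) (real (total_degree f)) A)"
    by (simp add: l_def d_def)
qed

section \<open>Values at zero, and products of polynomials\<close>

lemma Mahler_zeta_at_0:
  fixes f g :: "('p::finite, complex) mpoly"
  assumes "log_symbol (\<lambda>k. L (lattice_point k)) (total_degree f)"
  shows "of_nat (total_degree f) * Mahler_zeta f L g 0 =
    value_at_zero (Suc (total_degree g)) (\<lambda>k. eval_real g (lattice_point k))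
      (log_increment (\<lambda>k. L (lattice_point k)) (total_degree f))"
proof -
  interpret log_symbol "\<lambda>k. L (lattice_point k)" "real (total_degree f)" by fact
  obtain Z where Z: "Z nicely_meromorphic_on UNIV"
    "\<And>s. Re s > (real (Suc (total_degree g)) - 1 + real CARD('p)) / real (total_degree f) \<Longrightarrow>
      ((\<lambda>k. eval_real g (lattice_point k) * exp (- s * L (lattice_point k))) has_sum Z s) UNIV"
    "of_real (real (total_degree f)) * Z 0 =
      value_at_zero (Suc (total_degree g)) (\<lambda>k. eval_real g (lattice_point k))
      (log_increment (\<lambda>k. L (lattice_point k)) (total_degree f))"
    by (rule dyadic_poly_continuation[OF dyadic_poly_eval[of g]]) blast
  \<comment> \<open>As \<open>Suc (total_degree g) - 1\<close> is the degree of \<open>g\<close>,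
    the half-plane is exactly that of the definition.\<close>
  have "is_zeta_continuation f L g Z"
    unfolding is_zeta_continuation_def using Z(1,2) by simp
  hence "Mahler_zeta f L g = Z"
    unfolding Mahler_zeta_def by (blast intro: the_equality is_zeta_continuation_unique)
  thus ?thesis
    using Z(3) by simp
qed

text \<open>A drop in degree would contradict growth: the lower bounds of the factors multiply,
  while the product is at most a constant times its own degree's power of the weight. Large diagonal
  points (n, ..., n) separate the two powers.\<close>

lemma total_degree_prod_Mahler:
  fixes f :: "'j \<Rightarrow> ('p::finite, complex) mpoly"
  assumes "\<And>j. j \<in> J \<Longrightarrow> Mahler_hypothesis (f j)"
  shows "total_degree (\<Prod>j\<in>J. f j) = (\<Sum>j\<in>J. total_degree (f j))"
proof (rule antisym[OF total_degree_prod_le], rule ccontr)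
  define F where "F = (\<Prod>j\<in>J. f j)"
  define d where "d = (\<Sum>j\<in>J. total_degree (f j))"
  assume "\<not> (\<Sum>j\<in>J. total_degree (f j)) \<le> total_degree (\<Prod>j\<in>J. f j)"
  hence less: "Suc (total_degree F) \<le> d" by (simp add: F_def d_def)
  have "\<exists>c>0. \<forall>k. norm (eval_real (f j) (lattice_point k)) \<ge> c * wt k ^ total_degree (f j)"
    if "j \<in> J" for j
    using Mahler_lower_bound[OF assms[OF that]] by metis
  then obtain c where c: "\<And>j. j \<in> J \<Longrightarrow> c j > 0"
    "\<And>j k. j \<in> J \<Longrightarrow> norm (eval_real (f j) (lattice_point k)) \<ge> c j * wt k ^ total_degree (f j)"
    by metis
  define c' where "c' = (\<Prod>j\<in>J. c j)"
  have "c' > 0" using c(1) by (auto simp: c'_def intro: prod_pos)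
  obtain C where C: "\<And>x :: real ^ 'p. x \<in> nonneg_orthant \<Longrightarrow> norm (eval_real F x) \<le> C * orthant_wt x ^ total_degree F"
    using dilation_regularE[OF dilation_regular_eval[OF order_refl, of F]] by metis
  have bound: "c' * wt k \<le> C" for k :: "'p \<Rightarrow> nat"
  proof -
    have "c' * wt k ^ d = (\<Prod>j\<in>J. c j * wt k ^ total_degree (f j))"
      by (simp add: c'_def d_def prod.distrib power_sum)
    also have "\<dots> \<le> (\<Prod>j\<in>J. norm (eval_real (f j) (lattice_point k)))"
      using c wt_pos[of k] by (intro prod_mono) (auto intro: less_imp_le)
    also have "\<dots> = norm (eval_real F (lattice_point k))"
      by (simp add: F_def eval_real_prod prod_norm)
    also have "\<dots> \<le> C * wt k ^ total_degree F"
      using C[OF lattice_point_orthant, of k] by (simp add: orthant_wt_lattice_point)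
    finally have "c' * wt k ^ d \<le> C * wt k ^ total_degree F" .
    moreover have "wt k ^ Suc (total_degree F) \<le> wt k ^ d"
      using wt_ge_1[of k] less by (intro power_increasing)
    hence "c' * wt k ^ Suc (total_degree F) \<le> c' * wt k ^ d"
      using \<open>c' > 0\<close> by simp
    ultimately have "(c' * wt k) * wt k ^ total_degree F \<le> C * wt k ^ total_degree F"
      by (simp add: mult.assoc)
    thus ?thesis
      using wt_pos[of k] by simp
  qed
  obtain n where n: "real n > C / c'"
    using reals_Archimedean2 by blast
  have "real n \<le> wt (\<lambda>_ :: 'p. n)"
    using le_wt[of "\<lambda>_. n"] .
  hence "c' * real n \<le> C"
    using bound[of "\<lambda>_. n"] \<open>c' > 0\<close> by (meson mult_left_mono less_imp_le order_trans)
  thus False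
    using n \<open>c' > 0\<close> by (simp add: field_simps)
qed

text \<open>\<open>M\<close> and the sum of the \<open>L j\<close> have equal exponentials on the
  connected orthant, so they differ by a constant, and differences of values do not see it.\<close>

lemma log_branch_prod_diff:
  fixes f :: "'j \<Rightarrow> ('p::finite, complex) mpoly"
  assumes "finite J" "\<And>j. j \<in> J \<Longrightarrow> log_branch (f j) (L j)" "log_branch (\<Prod>j\<in>J. f j) M"
    and "x \<in> nonneg_orthant" "y \<in> nonneg_orthant"
  shows "M x - M y = (\<Sum>j\<in>J. L j x - L j y)"
proof -
  define g where "g = (\<lambda>x. M x - (\<Sum>j\<in>J. L j x))"
  have "convex (nonneg_orthant :: (real ^ 'p) set)"
    by (auto simp: convex_def nonneg_orthant_def)
  hence "connected (nonneg_orthant :: (real ^ 'p) set)"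
    by (rule convex_connected)
  moreover have "continuous_on nonneg_orthant g"
    unfolding g_def using assms by (intro continuous_intros) (auto simp: log_branch_def)
  moreover have "exp (g z) = 1" if z: "z \<in> nonneg_orthant" for z
  proof -
    have "exp (M z) = (\<Prod>j\<in>J. eval_real (f j) z)"
      using assms(3) z by (simp add: log_branch_def eval_real_prod)
    also have "\<dots> = (\<Prod>j\<in>J. exp (L j z))"
      using assms(2) z by (intro prod.cong) (auto simp: log_branch_def)
    finally show ?thesis
      using assms(1) by (simp add: g_def exp_diff exp_sum)
  qed
  ultimately have "g x = g y"
    using exp_eq_1_imp_eq assms(4,5) by metis
  thus ?thesis
    by (simp add: g_def sum_subtractf algebra_simps)
qed

theorem theorem1:
  fixes n :: nat
    and f :: "nat \<Rightarrow> ('p::finite, complex) mpoly"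
    and g :: "('p, complex) mpoly"
    and L :: "nat \<Rightarrow> real ^ 'p \<Rightarrow> complex"
    and M :: "real ^ 'p \<Rightarrow> complex"
  assumes "n \<ge> 1"
    and "\<And>j. j \<in> {1..n} \<Longrightarrow> Mahler_hypothesis (f j)"
    and "\<And>j. j \<in> {1..n} \<Longrightarrow> log_branch (f j) (L j)"
    and "log_branch (\<Prod>j=1..n. f j) M"
  shows "of_nat (total_degree (\<Prod>j=1..n. f j)) * Mahler_zeta (\<Prod>j=1..n. f j) M g 0
       = (\<Sum>j=1..n. of_nat (total_degree (f j)) * Mahler_zeta (f j) (L j) g 0)"
proof -
  let ?F = "\<Prod>j=1..n. f j"
  let ?G = "\<lambda>k. eval_real g (lattice_point k)"
  let ?l = "\<lambda>j. log_increment (\<lambda>k. L j (lattice_point k)) (total_degree (f j))"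
  let ?m = "log_increment (\<lambda>k. M (lattice_point k)) (total_degree ?F)"
  have L: "log_symbol (\<lambda>k. L j (lattice_point k)) (total_degree (f j))" if "j \<in> {1..n}" for j
    using log_branch_log_symbol assms(2,3) that by blast
  have l: "symbol (- 1) (\<lambda>_. ?l j A)" if "j \<in> {1..n}" for j A
    by (rule log_symbol.symbol_increment[OF L[OF that]])
  have deg: "total_degree ?F = (\<Sum>j=1..n. total_degree (f j))"
    by (rule total_degree_prod_Mahler[OF assms(2)])
  \<comment> \<open>The constant between the branches cancels in an increment, and additivity of the
    degree matches the terms \<open>D * ln 2\<close>.\<close>
  have m: "?m = (\<lambda>A k. \<Sum>j=1..n. ?l j A k)"
  proof (intro ext)
    fix A k
    have "M (lattice_point (dbl A k)) - M (lattice_point k) =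
        (\<Sum>j=1..n. L j (lattice_point (dbl A k)) - L j (lattice_point k))"
      by (rule log_branch_prod_diff[OF _ assms(3,4)]) (auto intro: lattice_point_orthant)
    thus "?m A k = (\<Sum>j=1..n. ?l j A k)"
      unfolding log_increment_def deg by (simp add: sum_subtractf sum_distrib_right)
  qed
  \<comment> \<open>The increments of \<open>M\<close> are sums of symbols, so they are symbols;
    positivity of the degree comes from the first factor, present since
    \<open>n \<ge> 1\<close>.\<close>
  have M: "log_symbol (\<lambda>k. M (lattice_point k)) (total_degree ?F)"
  proof
    have "total_degree (f 1) > 0"
      using assms(1) by (intro Mahler_total_degree_pos assms(2)) auto
    moreover have "total_degree (f 1) \<le> total_degree ?F"
      unfolding deg using assms(1) by (intro member_le_sum) auto
    ultimately show "real (total_degree ?F) > 0"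
      by simp
    show "symbol (- 1) (\<lambda>_. ?m A)" for A
      unfolding m by (rule symbol_sum[OF l])
  qed
  have "of_nat (total_degree ?F) * Mahler_zeta ?F M g 0 = value_at_zero (Suc (total_degree g)) ?G ?m"
    by (rule Mahler_zeta_at_0[OF M])
  also have "\<dots> = (\<Sum>j=1..n. value_at_zero (Suc (total_degree g)) ?G (?l j))"
    unfolding m by (rule value_at_zero_sum[OF l dyadic_poly_eval])
  also have "\<dots> = (\<Sum>j=1..n. of_nat (total_degree (f j)) * Mahler_zeta (f j) (L j) g 0)"
    by (intro sum.cong refl Mahler_zeta_at_0[OF L, symmetric])
  finally show ?thesis .
qed

end
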